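(* Let $P\in\mathbb{S}^n_+$, $q\in\mathbb{R}^n$, $G\in\mathbb{R}^{m\times n}$, $h\in\mathbb{R}^m$, $A\in\mathbb{R}^{p\times n}$, $b\in\mathbb{R}^p$, and $\mu_I,\mu_E>0$. Assume that the relaxed objective $$\phi(x,s;\mu_I,\mu_E)=\tfrac12 x^\top P x+q^\top x+\mu_I\|Gx+s-h\|_1+\mu_E\|Ax-b\|_1,\qquad x\in\mathbb{R}^n,\ s\in\mathbb{R}^m,\ s\ge0,$$ is not unbounded below. Then the FlexQP algorithm (defined in the context, with any parameters $\sigma_x,\sigma_s,\rho_I,\rho_E>0$, $\alpha\in(0,2)$ and any initialization) converges to a saddle point $(\hat{\tilde{\boldsymbol x}},\hat{\boldsymbol x},\hat{\boldsymbol y})$ of the Lagrangian $$\mathcal{L}(\tilde{\boldsymbol x},\boldsymbol x,\boldsymbol y)=f(\tilde{\boldsymbol x})+g(\boldsymbol x)+\boldsymbol y^\top(\tilde{\boldsymbol x}-\boldsymbol x),$$ where $f,g$ are the functions defined in the context; that is, the iterates $(\tilde{\boldsymbol x}^k,\boldsymbol x^k,\boldsymbol y^k)$ converge as $k\to\infty$ to such a saddle point.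
   Context: $\mathbb{S}^n_+$ denotes the symmetric positive semidefinite $n\times n$ real matrices; vector inequalities are componentwise. No rank assumptions are made on $G$ or $A$. Split problem. Write $\tilde{\boldsymbol x}=(\tilde x,\tilde s,\tilde z_I,\tilde z_E)$ and $\boldsymbol x=(x,s,z_I,z_E)$, both in $\mathbb{R}^n\times\mathbb{R}^m\times\mathbb{R}^m\times\mathbb{R}^p$, and $\boldsymbol y=(w_x,w_s,y_I,y_E)$ in the same space. The relaxed problem $\min_{x,\,s\ge 0}\phi(x,s;\mu_I,\mu_E)$ is written as: minimize $f(\tilde{\boldsymbol x})+g(\boldsymbol x)$ subject to $\tilde{\boldsymbol x}=\boldsymbol x$, where $f(\tilde{\boldsymbol x})=\tfrac12\tilde x^\top P\tilde x+q^\top\tilde x$ if $\tilde z_I=G\tilde x+\tilde s-h$ and $\tilde z_E=A\tilde x-b$, and $f(\tilde{\boldsymbol x})=+\infty$ otherwise; $g(\boldsymbol x)=\mu_I\|z_I\|_1+\mu_E\|z_E\|_1$ if $s\ge0$, and $g(\boldsymbol x)=+\infty$ otherwise. A saddle point of $\mathcal L$ is a triple with $\mathcal L(\hat{\tilde{\boldsymbol x}},\hat{\boldsymbol x},\boldsymbol y)\le\mathcal L(\hat{\tilde{\boldsymbol x}},\hat{\boldsymbol x},\hat{\boldsymbol y})\le\mathcal L(\tilde{\boldsymbol x},\boldsymbol x,\hat{\boldsymbol y})$ for all $\tilde{\boldsymbol x},\boldsymbol x,\boldsymbol y$. FlexQP algorithm (over-relaxed two-block ADMM on the split problem). Fixed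 scalar parameters $\sigma_x,\sigma_s,\rho_I,\rho_E>0$, relaxation parameter $\alpha\in(0,2)$, and an initialization $x^0,s^0,z_I^0,z_E^0,w_s^0,y_I^0,y_E^0$. Let $(t)_+=\max(t,0)$ and $S_\kappa(z)=(z-\kappa)_+-(-z-\kappa)_+$, both applied componentwise. For $k=0,1,2,\dots$: 1. Solve for $(\tilde x^{k+1},\tilde\nu_I^{k+1},\tilde\nu_E^{k+1})$ the linear system $$\begin{bmatrix} P+\sigma_xI & G^\top & A^\top \\ G & -(\sigma_s^{-1}+\rho_I^{-1})I & 0 \\ A & 0 & -\rho_E^{-1}I \end{bmatrix}\begin{bmatrix} \tilde x \\ \tilde\nu_I \\ \tilde\nu_E \end{bmatrix}=\begin{bmatrix} \sigma_xx^k-q \\ h-s^k+\sigma_s^{-1}w_s^k+z_I^k-\rho_I^{-1}y_I^k \\ b+z_E^k-\rho_E^{-1}y_E^k \end{bmatrix}.$$ 2. $\tilde s^{k+1}=s^k-\sigma_s^{-1}w_s^k-\sigma_s^{-1}\tilde\nu_I^{k+1}$, $\ \tilde z_I^{k+1}=z_I^k-\rho_I^{-1}y_I^k+\rho_I^{-1}\tilde\nu_I^{k+1}$, $\ \tilde z_E^{k+1}=z_E^k-\rho_E^{-1}y_E^k+\rho_E^{-1}\tilde\nu_E^{k+1}$. (Steps 1–2 compute the minimizer over $\tilde{\boldsymbol x}$ of $f(\tilde{\boldsymbol x})+\tfrac{\sigma_x}2\|\tilde x-x^k\|_2^2+\tfrac{\sigma_s}2\|\tilde s-s^k+\sigma_s^{-1}w_s^k\|_2^2+\tfrac{\rho_I}2\|\tilde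 z_I-z_I^k+\rho_I^{-1}y_I^k\|_2^2+\tfrac{\rho_E}2\|\tilde z_E-z_E^k+\rho_E^{-1}y_E^k\|_2^2$.) 3. $x^{k+1}=\alpha\tilde x^{k+1}+(1-\alpha)x^k$; $\ s^{k+1}=(\alpha\tilde s^{k+1}+(1-\alpha)s^k+\sigma_s^{-1}w_s^k)_+$; $\ z_I^{k+1}=S_{\mu_I/\rho_I}(\alpha\tilde z_I^{k+1}+(1-\alpha)z_I^k+\rho_I^{-1}y_I^k)$; $\ z_E^{k+1}=S_{\mu_E/\rho_E}(\alpha\tilde z_E^{k+1}+(1-\alpha)z_E^k+\rho_E^{-1}y_E^k)$. 4. $w_s^{k+1}=w_s^k+\sigma_s(\alpha\tilde s^{k+1}+(1-\alpha)s^k-s^{k+1})$; $\ y_I^{k+1}=y_I^k+\rho_I(\alpha\tilde z_I^{k+1}+(1-\alpha)z_I^k-z_I^{k+1})$; $\ y_E^{k+1}=y_E^k+\rho_E(\alpha\tilde z_E^{k+1}+(1-\alpha)z_E^k-z_E^{k+1})$. The multiplier $w_x$ for $\tilde x=x$ is identically zero along the algorithm, i.e. $w_x^k=0$ for all $k$, so $\boldsymbol y^k=(0,w_s^k,y_I^k,y_E^k)$. *)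

theory Defs
  imports "HOL-Analysis.Analysis"
begin

definition pos_semidef :: "real^'n^'n \<Rightarrow> bool" where
  "pos_semidef P \<longleftrightarrow> transpose P = P \<and> (\<forall>x. 0 \<le> x \<bullet> (P *v x))"

definition norm1 :: "real^'k \<Rightarrow> real" where
  "norm1 v = (\<Sum>i\<in>UNIV. \<bar>v $ i\<bar>)"

definition pos_part :: "real^'k \<Rightarrow> real^'k" where
  "pos_part v = (\<chi> i. max (v $ i) 0)"

definition soft_threshold :: "real \<Rightarrow> real^'k \<Rightarrow> real^'k" where
  "soft_threshold \<kappa> v = (\<chi> i. max (v $ i - \<kappa>) 0 - max (- (v $ i) - \<kappa>) 0)"

definition relaxed_objective ::
  "real^'n^'n \<Rightarrow> real^'n \<Rightarrow> real^'n^'m \<Rightarrow> real^'m \<Rightarrow> real^'n^'p \<Rightarrow> real^'p \<Rightarrow> real \<Rightarrow> real \<Rightarrow>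
   real^'n \<Rightarrow> real^'m \<Rightarrow> real" where
  "relaxed_objective P q G h A b \<mu>I \<mu>E x s =
     1/2 * (x \<bullet> (P *v x)) + q \<bullet> x + \<mu>I * norm1 (G *v x + s - h) + \<mu>E * norm1 (A *v x - b)"

text \<open>A point of the split problem is a tuple \<open>(x, s, zI, zE)\<close>; inner product and topology on
  such tuples are those of the product type. The order on vectors is componentwise.\<close>

type_synonym ('n, 'm, 'p) split_vec = "(real^'n) \<times> (real^'m) \<times> (real^'m) \<times> (real^'p)"

fun split_f ::
  "real^'n^'n \<Rightarrow> real^'n \<Rightarrow> real^'n^'m \<Rightarrow> real^'m \<Rightarrow> real^'n^'p \<Rightarrow> real^'p \<Rightarrow>
   ('n, 'm, 'p) split_vec \<Rightarrow> ereal" where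
  "split_f P q G h A b (x, s, zI, zE) =
     (if zI = G *v x + s - h \<and> zE = A *v x - b
      then ereal (1/2 * (x \<bullet> (P *v x)) + q \<bullet> x) else \<infinity>)"

fun split_g :: "real \<Rightarrow> real \<Rightarrow> ('n::finite, 'm::finite, 'p::finite) split_vec \<Rightarrow> ereal" where
  "split_g \<mu>I \<mu>E (x, s, zI, zE) =
     (if 0 \<le> s then ereal (\<mu>I * norm1 zI + \<mu>E * norm1 zE) else \<infinity>)"

definition lagrangian ::
  "('v::real_inner \<Rightarrow> ereal) \<Rightarrow> ('v \<Rightarrow> ereal) \<Rightarrow> 'v \<Rightarrow> 'v \<Rightarrow> 'v \<Rightarrow> ereal" where
  "lagrangian f g xt x y = f xt + g x + ereal (y \<bullet> (xt - x))"

definition saddle_point :: "('v \<Rightarrow> 'v \<Rightarrow> 'v \<Rightarrow> ereal) \<Rightarrow> 'v \<Rightarrow> 'v \<Rightarrow> 'v \<Rightarrow> bool" where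
  "saddle_point L xt x y \<longleftrightarrow>
     (\<forall>xt' x' y'. L xt x y' \<le> L xt x y \<and> L xt x y \<le> L xt' x' y)"

text \<open>The three block rows of the symmetric linear system, with right-hand side \<open>(r1, r2, r3)\<close>.\<close>

definition kkt_system ::
  "real^'n^'n \<Rightarrow> real^'n^'m \<Rightarrow> real^'n^'p \<Rightarrow> real \<Rightarrow> real \<Rightarrow> real \<Rightarrow> real \<Rightarrow>
   real^'n \<Rightarrow> real^'m \<Rightarrow> real^'p \<Rightarrow> real^'n \<Rightarrow> real^'m \<Rightarrow> real^'p \<Rightarrow> bool" where
  "kkt_system P G A \<sigma>x \<sigma>s \<rho>I \<rho>E r1 r2 r3 xt \<nu>I \<nu>E \<longleftrightarrow>
     (P + \<sigma>x *\<^sub>R mat 1) *v xt + transpose G *v \<nu>I + transpose A *v \<nu>E = r1 \<and>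
     G *v xt - (inverse \<sigma>s + inverse \<rho>I) *\<^sub>R \<nu>I = r2 \<and>
     A *v xt - inverse \<rho>E *\<^sub>R \<nu>E = r3"

text \<open>One iteration, from the state \<open>(x, s, zI, zE)\<close>, \<open>(ws, yI, yE)\<close> to the new auxiliary point
  \<open>(xt, st, ztI, ztE)\<close> and the new state \<open>(x', s', zI', zE')\<close>, \<open>(ws', yI', yE')\<close>. The multiplier of
  the constraint \<open>xt = x\<close> vanishes throughout and is not part of the state. It is a relation
  because the linear system defines its solution only implicitly; by \<open>kkt_system_ex1\<close> below, for
  positive semidefinite \<open>P\<close> and positive parameters it is the graph of a total function.\<close>

fun flexqp_step ::
  "real^'n^'n \<Rightarrow> real^'n \<Rightarrow> real^'n^'m \<Rightarrow> real^'m \<Rightarrow> real^'n^'p \<Rightarrow> real^'p \<Rightarrow> real \<Rightarrow> real \<Rightarrow>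
   real \<Rightarrow> real \<Rightarrow> real \<Rightarrow> real \<Rightarrow> real \<Rightarrow>
   ('n, 'm, 'p) split_vec \<Rightarrow> (real^'m) \<times> (real^'m) \<times> (real^'p) \<Rightarrow>
   ('n, 'm, 'p) split_vec \<Rightarrow>
   ('n, 'm, 'p) split_vec \<Rightarrow> (real^'m) \<times> (real^'m) \<times> (real^'p) \<Rightarrow> bool" where
  "flexqp_step P q G h A b \<mu>I \<mu>E \<sigma>x \<sigma>s \<rho>I \<rho>E \<alpha>
     (x, s, zI, zE) (ws, yI, yE) (xt, st, ztI, ztE) (x', s', zI', zE') (ws', yI', yE') \<longleftrightarrow>
   (\<exists>\<nu>I \<nu>E.
      kkt_system P G A \<sigma>x \<sigma>s \<rho>I \<rho>E
        (\<sigma>x *\<^sub>R x - q)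
        (h - s + inverse \<sigma>s *\<^sub>R ws + zI - inverse \<rho>I *\<^sub>R yI)
        (b + zE - inverse \<rho>E *\<^sub>R yE) xt \<nu>I \<nu>E \<and>
      st = s - inverse \<sigma>s *\<^sub>R ws - inverse \<sigma>s *\<^sub>R \<nu>I \<and>
      ztI = zI - inverse \<rho>I *\<^sub>R yI + inverse \<rho>I *\<^sub>R \<nu>I \<and>
      ztE = zE - inverse \<rho>E *\<^sub>R yE + inverse \<rho>E *\<^sub>R \<nu>E) \<and>
   x' = \<alpha> *\<^sub>R xt + (1 - \<alpha>) *\<^sub>R x \<and>
   s' = pos_part (\<alpha> *\<^sub>R st + (1 - \<alpha>) *\<^sub>R s + inverse \<sigma>s *\<^sub>R ws) \<and>
   zI' = soft_threshold (\<mu>I / \<rho>I) (\<alpha> *\<^sub>R ztI + (1 - \<alpha>) *\<^sub>R zI + inverse \<rho>I *\<^sub>R yI) \<and>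
   zE' = soft_threshold (\<mu>E / \<rho>E) (\<alpha> *\<^sub>R ztE + (1 - \<alpha>) *\<^sub>R zE + inverse \<rho>E *\<^sub>R yE) \<and>
   ws' = ws + \<sigma>s *\<^sub>R (\<alpha> *\<^sub>R st + (1 - \<alpha>) *\<^sub>R s - s') \<and>
   yI' = yI + \<rho>I *\<^sub>R (\<alpha> *\<^sub>R ztI + (1 - \<alpha>) *\<^sub>R zI - zI') \<and>
   yE' = yE + \<rho>E *\<^sub>R (\<alpha> *\<^sub>R ztE + (1 - \<alpha>) *\<^sub>R zE - zE')"

lemma kkt_system_ex1:
  fixes P :: "real^'n^'n" and G :: "real^'n^'m" and A :: "real^'n^'p"
  assumes P: "pos_semidef P" and pos: "\<sigma>x > 0" "\<sigma>s > 0" "\<rho>I > 0" "\<rho>E > 0"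
  shows "\<exists>!(xt, \<nu>I, \<nu>E). kkt_system P G A \<sigma>x \<sigma>s \<rho>I \<rho>E r1 r2 r3 xt \<nu>I \<nu>E"
proof -
  define c where "c = inverse (inverse \<sigma>s + inverse \<rho>I)"
  have c: "c > 0" and ci: "inverse \<sigma>s + inverse \<rho>I = inverse c"
    using pos by (auto simp: c_def intro!: add_pos_pos)
  define M where "M = (\<lambda>x. (P + \<sigma>x *\<^sub>R mat 1) *v x + c *\<^sub>R (transpose G *v (G *v x))
      + \<rho>E *\<^sub>R (transpose A *v (A *v x)))"
  have lin: "linear M"
    unfolding M_def
    by (intro linear_compose_add linear_compose_scale_right matrix_vector_mul_linear
      linear_compose[OF matrix_vector_mul_linear matrix_vector_mul_linear, unfolded o_def])
  have sq: "x \<bullet> (transpose B *v (B *v x)) = (B *v x) \<bullet> (B *v x)" for x and B :: "real^'n^'k"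
    by (metis dot_lmul_matrix inner_commute transpose_matrix_vector)
  have "x = 0" if "M x = 0" for x
  proof -
    have "0 = x \<bullet> M x" using that by simp
    also have "\<dots> = x \<bullet> (P *v x) + \<sigma>x * (x \<bullet> x)
        + c * ((G *v x) \<bullet> (G *v x)) + \<rho>E * ((A *v x) \<bullet> (A *v x))"
      by (simp add: M_def inner_add_right sq[simplified] matrix_vector_mult_add_rdistrib
          scaleR_matrix_vector_assoc[symmetric])
    also have "\<dots> \<ge> \<sigma>x * (x \<bullet> x)"
      using P c pos by (simp add: pos_semidef_def)
    finally show "x = 0"
      using pos by (simp add: mult_le_0_iff) (meson inner_gt_zero_iff not_le)
  qed
  then have "inj M"
    using lin linear_injective_0 by blast
  then have bij: "bij M"
    using lin linear_injective_imp_surjective by (auto simp: bij_def)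
  have elim: "kkt_system P G A \<sigma>x \<sigma>s \<rho>I \<rho>E r1 r2 r3 x \<nu> \<nu>' \<longleftrightarrow>
      M x = r1 + c *\<^sub>R (transpose G *v r2) + \<rho>E *\<^sub>R (transpose A *v r3) \<and>
      \<nu> = c *\<^sub>R (G *v x - r2) \<and> \<nu>' = \<rho>E *\<^sub>R (A *v x - r3)" for x \<nu> \<nu>'
  proof -
    have row: "u - inverse d *\<^sub>R v = r \<longleftrightarrow> v = d *\<^sub>R (u - r)"
      if "d > 0" for d :: real and u v r :: "real^'k"
    proof
      assume "u - inverse d *\<^sub>R v = r"
      then have "u - r = inverse d *\<^sub>R v" by (simp add: algebra_simps)
      then show "v = d *\<^sub>R (u - r)" using that by simp
    qed (use that in simp)
    have tr: "transpose B *v (d *\<^sub>R (u - r)) = d *\<^sub>R (transpose B *v u) - d *\<^sub>R (transpose B *v r)"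
      for d and u r :: "real^'k" and B :: "real^'n^'k"
      by (simp only: matrix_vector_mult_scaleR matrix_vector_mult_diff_distrib scaleR_diff_right)
    have shuffle: "u + (v - v') + (w - w') = r \<longleftrightarrow> u + v + w = r + v' + w'"
      for u v v' w w' r :: "real^'n"
      by (simp add: algebra_simps)
    have main: "(P + \<sigma>x *\<^sub>R mat 1) *v x + transpose G *v (c *\<^sub>R (G *v x - r2))
          + transpose A *v (\<rho>E *\<^sub>R (A *v x - r3)) = r1 \<longleftrightarrow>
        M x = r1 + c *\<^sub>R (transpose G *v r2) + \<rho>E *\<^sub>R (transpose A *v r3)"
      unfolding tr M_def by (rule shuffle)
    show ?thesis
      unfolding kkt_system_def ci row[OF c] row[OF pos(4)] main[symmetric] by blast
  qed
  obtain x where x: "M x = r1 + c *\<^sub>R (transpose G *v r2) + \<rho>E *\<^sub>R (transpose A *v r3)"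
    using bij by (metis bij_pointE)
  show ?thesis
  proof (rule ex1I[of _ "(x, c *\<^sub>R (G *v x - r2), \<rho>E *\<^sub>R (A *v x - r3))"])
    show "case (x, c *\<^sub>R (G *v x - r2), \<rho>E *\<^sub>R (A *v x - r3)) of (xt, \<nu>I, \<nu>E) \<Rightarrow>
        kkt_system P G A \<sigma>x \<sigma>s \<rho>I \<rho>E r1 r2 r3 xt \<nu>I \<nu>E"
      using x by (simp only: elim prod.case simp_thms)
  next
    fix t assume "case t of (xt, \<nu>I, \<nu>E) \<Rightarrow> kkt_system P G A \<sigma>x \<sigma>s \<rho>I \<rho>E r1 r2 r3 xt \<nu>I \<nu>E"
    moreover obtain x' \<nu> \<nu>' where t': "t = (x', \<nu>, \<nu>')"
      by (cases t)
    ultimately have x': "M x' = r1 + c *\<^sub>R (transpose G *v r2) + \<rho>E *\<^sub>R (transpose A *v r3)"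
      and t: "t = (x', c *\<^sub>R (G *v x' - r2), \<rho>E *\<^sub>R (A *v x' - r3))"
      by (simp_all only: elim prod.case)
    have "x' = x"
      using injD[OF \<open>inj M\<close>] x x' by metis
    then show "t = (x, c *\<^sub>R (G *v x - r2), \<rho>E *\<^sub>R (A *v x - r3))"
      using t by blast
  qed
qed

end

theory Submission
  imports Defs
begin

text \<open>
  The iteration is an over-relaxed alternating direction method for \<open>f(xt) + g(x)\<close> subject to
  \<open>xt = x\<close>, in the metric \<open>D = diag(\<sigma>x, \<sigma>s, \<rho>I, \<rho>E)\<close>. Solving the linear system yields
  \<open>-(y + D (xt - x)) \<in> \<partial>f(xt)\<close>, while projection and soft thresholding yield \<open>y' \<in> \<partial>g(x')\<close> for the
  updated multiplier (\<open>flexqp_step_admm\<close>). A pair \<open>(x, y)\<close> with \<open>-y \<in> \<partial>f(x)\<close> and \<open>y \<in> \<partial>g(x)\<close> makes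
  \<open>(x, x, y)\<close> a saddle point (\<open>saddle_point_of_subgradients\<close>). The theorem thus splits into the
  existence of such a pair and the convergence of the method to one.

  Convergence needs only that the two subdifferentials are monotone relations with closed graphs
  (\<open>relaxed_admm_converges\<close>). After rescaling by the square root of \<open>D\<close> the metric is the identity.
  The sum \<open>u = x + y\<close> then moves by \<open>\<alpha> (xt - x)\<close>, and its squared distance to \<open>x* + y*\<close>, for every
  solution pair \<open>(x*, y*)\<close>, drops by at least \<open>\<alpha> (2 - \<alpha>) |xt - x|\<^sup>2\<close>. So \<open>xt - x\<close> tends to zero, the
  iterates are bounded, their cluster points solve the problem because the graphs are closed, and
  taking such a cluster point for \<open>(x*, y*)\<close> turns subsequential into full convergence.

  Existence is a Frank-Wolfe type theorem: a convex quadratic plus a polyhedral penalty attains its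
  infimum as soon as it is bounded below, and there it has a multiplier. Eliminating \<open>s\<close>, the penalty
  becomes the maximum of \<open>y \<bullet> (C x - d)\<close> over a box of multipliers \<open>y\<close>, where \<open>C x = (G x, A x)\<close> and
  \<open>d = (h, b)\<close>. With a small regularization \<open>\<epsilon>\<close> in \<open>x\<close> and in \<open>y\<close> the optimality system is a fixed
  point equation on the box, solvable by Brouwer's theorem (\<open>regularized_kkt_exists\<close>). The solutions
  \<open>x\<^sub>\<epsilon>\<close> may be unbounded as \<open>\<epsilon>\<close> tends to zero, but the lower bound forces \<open>\<epsilon> x\<^sub>\<epsilon>\<close> to tend to zero, so
  the optimality system is solved up to a vanishing residual. A box has finitely many normal cones, so
  one of them occurs infinitely often; along it the attainable right-hand sides form a linear image of
  a finitely generated cone. That image is closed, hence contains the limit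
  (\<open>kkt_exists_of_bounded_below\<close>).
\<close>

section \<open>Attainment for convex quadratics with a polyhedral penalty\<close>

text \<open>
  The normal cones of a box have this form, with \<open>I\<close> and \<open>J\<close> consisting of basis vectors. As there are
  only finitely many such sets, a sequence of points of the box has a subsequence along which the normal
  cone does not change.
\<close>

definition sign_cone :: "'a::euclidean_space set \<Rightarrow> 'a set \<Rightarrow> 'a set" where
  "sign_cone I J = {w. (\<forall>b\<in>I. w \<bullet> b \<le> 0) \<and> (\<forall>b\<in>J. 0 \<le> w \<bullet> b)}"

text \<open>
  Finite generation is what makes linear images of these cones closed: the linear image of an
  arbitrary closed convex cone need not be.
\<close>

lemma sign_cone_eq_convex_cone_hull:
  fixes I J :: "'a::euclidean_space set"
  assumes "I \<subseteq> Basis" "J \<subseteq> Basis"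
  shows "sign_cone I J = convex_cone hull ((Basis - I) \<union> uminus ` (Basis - J))" (is "_ = ?K")
proof
  show "sign_cone I J \<subseteq> ?K"
  proof
    fix w assume w: "w \<in> sign_cone I J"
    have coord: "(w \<bullet> b) *\<^sub>R b \<in> ?K" if b: "b \<in> Basis" for b
    proof (cases "w \<bullet> b" "0::real" rule: linorder_cases)
      case less
      then have "b \<notin> J" using w by (auto simp: sign_cone_def)
      then have "- b \<in> ?K" using b by (intro hull_inc) auto
      then have "(- (w \<bullet> b)) *\<^sub>R (- b) \<in> ?K"
        using less by (intro convex_cone_hull_mul) auto
      then show ?thesis by simp
    next
      case greater
      then have "b \<notin> I" using w by (auto simp: sign_cone_def)
      then have "b \<in> ?K" using b by (intro hull_inc) auto
      then show ?thesis
        using greater by (intro convex_cone_hull_mul) auto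
    qed (simp add: convex_cone_hull_contains_0)
    have "(\<Sum>b\<in>B. (w \<bullet> b) *\<^sub>R b) \<in> ?K" if "finite B" "B \<subseteq> Basis" for B
      using that
    proof (induction B)
      case (insert b B)
      then show ?case using coord[of b] by (simp add: convex_cone_hull_add)
    qed (simp add: convex_cone_hull_contains_0)
    then have "(\<Sum>b\<in>Basis. (w \<bullet> b) *\<^sub>R b) \<in> ?K"
      by simp
    then show "w \<in> ?K" by (simp add: euclidean_representation)
  qed
  have orth: "b \<bullet> c = (if b = c then 1 else 0)" if "b \<in> Basis" "c \<in> Basis" for b c :: 'a
    using that by (simp add: inner_Basis)
  show "?K \<subseteq> sign_cone I J"
  proof (rule hull_minimal)
    show "Basis - I \<union> uminus ` (Basis - J) \<subseteq> sign_cone I J"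
      using assms orth by (auto simp: sign_cone_def subset_iff)
    show "convex_cone (sign_cone I J)"
      unfolding convex_cone_iff sign_cone_def
      by (auto simp: inner_add_left mult_nonneg_nonneg mult_nonneg_nonpos add_nonpos_nonpos)
  qed
qed

lemma closed_linear_image_sign_cone:
  fixes T :: "'a::euclidean_space \<Rightarrow> 'b::euclidean_space"
  assumes "linear T" "I \<subseteq> Basis" "J \<subseteq> Basis"
  shows "closed (T ` sign_cone I J)"
  unfolding sign_cone_eq_convex_cone_hull[OF assms(2,3)]
  by (subst convex_cone_hull_linear_image[OF assms(1), symmetric])
     (intro closed_convex_cone_hull, simp)

lemma box_normal_iff_sign_cone:
  fixes y :: "'a::euclidean_space"
  assumes y: "y \<in> cbox l u"
  shows "(\<forall>y'\<in>cbox l u. (y' - y) \<bullet> w \<le> 0) \<longleftrightarrow>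
    w \<in> sign_cone {b\<in>Basis. y \<bullet> b < u \<bullet> b} {b\<in>Basis. l \<bullet> b < y \<bullet> b}" (is "?L \<longleftrightarrow> ?R")
proof
  assume L: ?L
  have coord: "t * (w \<bullet> b) \<le> 0" if "b \<in> Basis" "l \<bullet> b \<le> y \<bullet> b + t" "y \<bullet> b + t \<le> u \<bullet> b" for b t
  proof -
    have "y + t *\<^sub>R b \<in> cbox l u"
      using y that by (auto simp: mem_box inner_add_left inner_Basis)
    with L have "(y + t *\<^sub>R b - y) \<bullet> w \<le> 0" by blast
    then show ?thesis by (simp add: inner_commute)
  qed
  show ?R
    unfolding sign_cone_def
  proof (intro CollectI conjI ballI)
    fix b assume "b \<in> {b\<in>Basis. y \<bullet> b < u \<bullet> b}"
    then show "w \<bullet> b \<le> 0"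
      using coord[of b "u \<bullet> b - y \<bullet> b"] y by (auto simp: mem_box mult_le_0_iff)
  next
    fix b assume "b \<in> {b\<in>Basis. l \<bullet> b < y \<bullet> b}"
    then show "0 \<le> w \<bullet> b"
      using coord[of b "l \<bullet> b - y \<bullet> b"] y by (auto simp: mem_box mult_le_0_iff)
  qed
next
  assume R: ?R
  show ?L
  proof
    fix y' assume y': "y' \<in> cbox l u"
    have "((y' - y) \<bullet> b) * (w \<bullet> b) \<le> 0" if b: "b \<in> Basis" for b
    proof -
      have "y' \<bullet> b \<le> u \<bullet> b" "l \<bullet> b \<le> y' \<bullet> b" using y' b by (auto simp: mem_box)
      moreover have "w \<bullet> b \<le> 0 \<or> y \<bullet> b \<ge> u \<bullet> b" "0 \<le> w \<bullet> b \<or> l \<bullet> b \<ge> y \<bullet> b"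
        using R b by (force simp: sign_cone_def)+
      ultimately show ?thesis
        unfolding inner_diff_left mult_le_0_iff by linarith
    qed
    then show "(y' - y) \<bullet> w \<le> 0"
      by (subst euclidean_inner) (intro sum_nonpos, blast)
  qed
qed

text \<open>
  For a given multiplier \<open>y\<close> the first equation determines \<open>x\<close>, since \<open>\<epsilon> I + H\<close> is invertible; the
  variational inequality says that \<open>y\<close> is the projection of \<open>(C x - d) / \<epsilon>\<close> onto \<open>Y\<close>. Together this is a
  fixed point equation for a continuous map of the compact convex set \<open>Y\<close> into itself.
\<close>

lemma regularized_kkt_exists:
  fixes H :: "'a::euclidean_space \<Rightarrow> 'a" and C :: "'a \<Rightarrow> 'b::euclidean_space"
  assumes H: "linear H" and psd: "\<And>x. 0 \<le> x \<bullet> H x" and C: "linear C"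
    and Y: "compact Y" "convex Y" "Y \<noteq> {}" and \<epsilon>: "\<epsilon> > 0"
  shows "\<exists>x. \<exists>y\<in>Y. \<epsilon> *\<^sub>R x + H x + q + adjoint C y = 0 \<and>
    (\<forall>y'\<in>Y. (y' - y) \<bullet> (C x - d - \<epsilon> *\<^sub>R y) \<le> 0)"
proof -
  define M where "M x = \<epsilon> *\<^sub>R x + H x" for x
  have M: "linear M"
    unfolding M_def by (intro linear_compose_add linear_scale_self H)
  have "x = 0" if "M x = 0" for x
  proof -
    have "0 = x \<bullet> M x" using that by simp
    also have "\<dots> = \<epsilon> * (x \<bullet> x) + x \<bullet> H x" by (simp add: M_def inner_add_right)
    also have "\<dots> \<ge> \<epsilon> * (x \<bullet> x)" using psd[of x] by simp
    finally show ?thesis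
      using \<epsilon> by (metis inner_gt_zero_iff mult_pos_pos not_le)
  qed
  then have "inj M" using M linear_injective_0 by blast
  then obtain R where R: "linear R" "\<And>x. M (R x) = x"
    using linear_injective_isomorphism[OF M] by blast
  define x where "x y = R (- q - adjoint C y)" for y
  define T where "T y = closest_point Y ((1 / \<epsilon>) *\<^sub>R (C (x y) - d))" for y
  have clY: "closed Y" using Y compact_imp_closed by blast
  have "continuous_on Y (\<lambda>y. (1 / \<epsilon>) *\<^sub>R (C (x y) - d))"
    unfolding x_def using C R adjoint_linear[OF C]
    by (intro continuous_intros linear_continuous_on_compose[of _ _ C]
       linear_continuous_on_compose[of _ _ R] linear_continuous_on_compose[of _ _ "adjoint C"])
  then have "continuous_on Y T"
    unfolding T_def
    by (rule continuous_on_compose2[OF continuous_on_closest_point[OF Y(2) clY Y(3), of UNIV]]) simp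
  moreover have "T \<in> Y \<rightarrow> Y"
    unfolding T_def using closest_point_in_set[OF clY Y(3)] by blast
  ultimately obtain y where y: "y \<in> Y" "T y = y"
    using brouwer[OF Y] by blast
  have "(y' - y) \<bullet> (C (x y) - d - \<epsilon> *\<^sub>R y) \<le> 0" if "y' \<in> Y" for y'
  proof -
    have "((1 / \<epsilon>) *\<^sub>R (C (x y) - d) - y) \<bullet> (y' - y) \<le> 0"
      using closest_point_dot[OF Y(2) clY that, of "(1 / \<epsilon>) *\<^sub>R (C (x y) - d)"] y(2)
      by (simp add: T_def)
    then have "\<epsilon> * (((1 / \<epsilon>) *\<^sub>R (C (x y) - d) - y) \<bullet> (y' - y)) \<le> 0"
      using \<epsilon> by (simp add: mult_le_0_iff)
    also have "\<epsilon> * (((1 / \<epsilon>) *\<^sub>R (C (x y) - d) - y) \<bullet> (y' - y))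
        = (\<epsilon> *\<^sub>R ((1 / \<epsilon>) *\<^sub>R (C (x y) - d) - y)) \<bullet> (y' - y)" by simp
    also have "\<epsilon> *\<^sub>R ((1 / \<epsilon>) *\<^sub>R (C (x y) - d) - y) = C (x y) - d - \<epsilon> *\<^sub>R y"
      using \<epsilon> by (simp add: scaleR_diff_right)
    finally show ?thesis by (simp add: inner_commute)
  qed
  moreover have "\<epsilon> *\<^sub>R x y + H (x y) + q + adjoint C y = 0"
    using R(2)[of "- q - adjoint C y"] by (simp add: M_def x_def)
  ultimately show ?thesis using y(1) by blast
qed

text \<open>
  The hypothesis says that the convex function \<open>\<lambda>x. 1/2 (x \<bullet> H x) + q \<bullet> x + (MAX y. y \<bullet> (C x - d))\<close>
  is bounded below, and the conclusion is the optimality condition for a minimizer together with a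
  multiplier. The lower bound enters only through the estimate \<open>\<epsilon> |x\<^sub>\<epsilon>|\<^sup>2 \<le> M\<close>, obtained by testing the
  regularized stationarity equation with \<open>x\<^sub>\<epsilon>\<close>.
\<close>

lemma kkt_exists_of_bounded_below:
  fixes H :: "'a::euclidean_space \<Rightarrow> 'a" and C :: "'a \<Rightarrow> 'b::euclidean_space"
  assumes H: "linear H" and psd: "\<And>x. 0 \<le> x \<bullet> H x" and C: "linear C"
    and bound: "\<And>x. \<exists>y\<in>cbox l u. B \<le> 1/2 * (x \<bullet> H x) + q \<bullet> x + y \<bullet> (C x - d)"
  shows "\<exists>x. \<exists>y\<in>cbox l u. H x + q + adjoint C y = 0 \<and>
    (\<forall>y'\<in>cbox l u. (y' - y) \<bullet> (C x - d) \<le> 0)"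
proof -
  let ?Y = "cbox l u"
  define \<epsilon> where "\<epsilon> k = inverse (real (Suc k))" for k
  have \<epsilon>: "0 < \<epsilon> k" "\<epsilon> k \<le> 1" for k by (auto simp: \<epsilon>_def divide_simps)
  have \<epsilon>0: "\<epsilon> \<longlonglongrightarrow> 0" unfolding \<epsilon>_def by (rule LIMSEQ_inverse_real_of_nat)
  have Yne: "?Y \<noteq> {}" using bound[of 0] by blast
  have "\<forall>k. \<exists>x. \<exists>y\<in>?Y. \<epsilon> k *\<^sub>R x + H x + q + adjoint C y = 0 \<and>
    (\<forall>y'\<in>?Y. (y' - y) \<bullet> (C x - d - \<epsilon> k *\<^sub>R y) \<le> 0)"
    using regularized_kkt_exists[OF H psd C compact_cbox convex_box(1) Yne \<epsilon>(1)] by blast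
  then obtain x y where y: "\<And>k. y k \<in> ?Y"
    and stat: "\<And>k. \<epsilon> k *\<^sub>R x k + H (x k) + q + adjoint C (y k) = 0"
    and nrm: "\<And>k y'. y' \<in> ?Y \<Longrightarrow> (y' - y k) \<bullet> (C (x k) - d - \<epsilon> k *\<^sub>R y k) \<le> 0"
    by metis
  obtain K where K: "\<And>y. y \<in> ?Y \<Longrightarrow> norm y \<le> K"
    using bounded_cbox bounded_iff by metis
  define M where "M = K * norm d + K\<^sup>2 + \<bar>B\<bar>"
  have M: "\<epsilon> k * (norm (x k))\<^sup>2 \<le> M" for k
  proof -
    define X v where "X = x k" and "v = C X - d"
    obtain y0 where y0: "y0 \<in> ?Y" "B \<le> 1/2 * (X \<bullet> H X) + q \<bullet> X + y0 \<bullet> v"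
      unfolding v_def using bound by blast
    have "(y0 - y k) \<bullet> (v - \<epsilon> k *\<^sub>R y k) \<le> 0"
      using nrm[OF y0(1)] by (simp add: v_def X_def)
    then have 1: "y0 \<bullet> v \<le> y k \<bullet> v + \<epsilon> k * (y0 \<bullet> y k - y k \<bullet> y k)"
      by (simp add: algebra_simps inner_diff_left inner_diff_right)
    have "y0 \<bullet> y k \<le> norm y0 * norm (y k)" by (rule norm_cauchy_schwarz)
    also have "\<dots> \<le> K * K" using K y y0 by (intro mult_mono) (auto intro: order_trans[OF norm_ge_zero])
    finally have "y0 \<bullet> y k - y k \<bullet> y k \<le> K\<^sup>2"
      using inner_ge_zero[of "y k"] unfolding power2_eq_square by linarith
    then have "\<epsilon> k * (y0 \<bullet> y k - y k \<bullet> y k) \<le> \<epsilon> k * K\<^sup>2"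
      using \<epsilon>(1)[of k] by (intro mult_left_mono) auto
    also have "\<dots> \<le> 1 * K\<^sup>2" using \<epsilon>(2)[of k] by (intro mult_right_mono) auto
    finally have "\<epsilon> k * (y0 \<bullet> y k - y k \<bullet> y k) \<le> 1 * K\<^sup>2" .
    with 1 have 2: "y0 \<bullet> v \<le> y k \<bullet> v + K\<^sup>2" by simp
    have "X \<bullet> (\<epsilon> k *\<^sub>R X + H X + q + adjoint C (y k)) = 0"
      using stat by (simp add: X_def)
    then have 3: "\<epsilon> k * (X \<bullet> X) + X \<bullet> H X + q \<bullet> X + C X \<bullet> y k = 0"
      by (simp add: inner_add_right adjoint_works[OF C] inner_commute)
    have "- (y k \<bullet> d) \<le> norm (y k) * norm d"
      using Cauchy_Schwarz_ineq2[of "y k" d] by linarith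
    also have "\<dots> \<le> K * norm d" using K y by (intro mult_right_mono) auto
    finally have 4: "- (y k \<bullet> d) \<le> K * norm d" .
    have "y k \<bullet> v = C X \<bullet> y k - y k \<bullet> d" by (simp add: v_def inner_diff_right inner_commute)
    then show ?thesis
      using 2 3 4 y0(2) psd[of X] unfolding X_def M_def power2_norm_eq_inner by linarith
  qed
  have "(\<lambda>k. \<epsilon> k *\<^sub>R x k) \<longlonglongrightarrow> 0"
  proof (rule tendsto_0_le[where K=1])
    show "(\<lambda>k. sqrt (\<epsilon> k * M)) \<longlonglongrightarrow> 0"
      using tendsto_real_sqrt[OF tendsto_mult_left_zero[OF \<epsilon>0, of M]] by simp
    show "\<forall>\<^sub>F k in sequentially. norm (\<epsilon> k *\<^sub>R x k) \<le> norm (sqrt (\<epsilon> k * M)) * 1"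
    proof (rule always_eventually, rule allI)
      fix k
      have "(norm (\<epsilon> k *\<^sub>R x k))\<^sup>2 = \<epsilon> k * (\<epsilon> k * (norm (x k))\<^sup>2)"
        by (simp add: power2_eq_square algebra_simps)
      also have "\<dots> \<le> \<epsilon> k * M" using M \<epsilon>(1)[of k] by (intro mult_left_mono) auto
      finally have "norm (\<epsilon> k *\<^sub>R x k) \<le> sqrt (\<epsilon> k * M)" by (rule real_le_rsqrt)
      then show "norm (\<epsilon> k *\<^sub>R x k) \<le> norm (sqrt (\<epsilon> k * M)) * 1" by simp
    qed
  qed
  note \<epsilon>x = this
  \<comment> \<open>Pass to a subsequence along which the normal cone \<open>N\<close> of the box is constant and \<open>y\<close> converges.\<close>
  define I J where "I k = {b\<in>Basis. y k \<bullet> b < u \<bullet> b}" and "J k = {b\<in>Basis. l \<bullet> b < y k \<bullet> b}" for k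
  have "finite (range (\<lambda>k. (I k, J k)))"
    by (rule finite_subset[of _ "Pow Basis \<times> Pow Basis"]) (auto simp: I_def J_def)
  then obtain k0 where "infinite {k. (I k, J k) = (I k0, J k0)}"
    using inf_img_fin_dom[of "\<lambda>k. (I k, J k)" UNIV] by (auto simp: vimage_def)
  from infinite_enumerate[OF this] obtain r :: "nat \<Rightarrow> nat"
    where r: "strict_mono r" "\<And>n. (I (r n), J (r n)) = (I k0, J k0)"
    by blast
  define N where "N = sign_cone (I k0) (J k0)"
  have N: "w \<in> N \<longleftrightarrow> (\<forall>y'\<in>?Y. (y' - y (r n)) \<bullet> w \<le> 0)" for w n
    using box_normal_iff_sign_cone[OF y[of "r n"]] r(2)[of n] by (simp add: N_def I_def J_def)
  obtain yl r' where yl: "yl \<in> ?Y" "strict_mono r'" "(y \<circ> r \<circ> r') \<longlonglongrightarrow> yl"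
    using compact_imp_seq_compact[OF compact_cbox[of l u]] y
    unfolding seq_compact_def by (metis comp_apply)
  \<comment> \<open>\<open>(v, c) \<in> D\<close> means that \<open>H x = v\<close> and \<open>C x - c \<in> N\<close> have a common solution \<open>x\<close>.\<close>
  define D where "D = (\<lambda>(x, w). (H x, C x - w)) ` (UNIV \<times> N)"
  have "linear (\<lambda>(x, w). (H x, C x - w))"
    using H C by (auto intro!: linearI simp: linear_add linear_scale split_def algebra_simps)
  moreover have "UNIV \<times> N = sign_cone (Pair 0 ` I k0) (Pair (0::'a) ` J k0)"
    by (auto simp: N_def sign_cone_def inner_Pair)
  moreover have "Pair (0::'a) ` I k0 \<subseteq> Basis" "Pair (0::'a) ` J k0 \<subseteq> Basis"
    by (auto simp: Basis_prod_def I_def J_def)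
  ultimately have "closed D"
    unfolding D_def by (metis closed_linear_image_sign_cone)
  define p where "p k = (- q - adjoint C (y k) - \<epsilon> k *\<^sub>R x k, d + \<epsilon> k *\<^sub>R y k)" for k
  have pD: "p (r (r' n)) \<in> D" for n
  proof -
    let ?k = "r (r' n)"
    have "C (x ?k) - d - \<epsilon> ?k *\<^sub>R y ?k \<in> N" using N nrm by blast
    moreover have "p ?k = (H (x ?k), C (x ?k) - (C (x ?k) - d - \<epsilon> ?k *\<^sub>R y ?k))"
    proof -
      have "H (x ?k) = (\<epsilon> ?k *\<^sub>R x ?k + H (x ?k) + q + adjoint C (y ?k))
          - q - adjoint C (y ?k) - \<epsilon> ?k *\<^sub>R x ?k" by simp
      then show ?thesis unfolding stat by (simp add: p_def)
    qed
    ultimately show ?thesis unfolding D_def by force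
  qed
  have rr: "strict_mono (r \<circ> r')" using r yl by (simp add: strict_mono_o)
  have yr: "(\<lambda>n. y (r (r' n))) \<longlonglongrightarrow> yl" using yl(3) by (simp add: o_def)
  have er: "(\<lambda>n. \<epsilon> (r (r' n))) \<longlonglongrightarrow> 0"
    using LIMSEQ_subseq_LIMSEQ[OF \<epsilon>0 rr] by (simp add: o_def)
  have exr: "(\<lambda>n. \<epsilon> (r (r' n)) *\<^sub>R x (r (r' n))) \<longlonglongrightarrow> 0"
    using LIMSEQ_subseq_LIMSEQ[OF \<epsilon>x rr] by (simp add: o_def)
  have adj: "(\<lambda>n. adjoint C (y (r (r' n)))) \<longlonglongrightarrow> adjoint C yl"
    by (rule bounded_linear.tendsto[OF _ yr])
       (simp add: linear_conv_bounded_linear[symmetric] adjoint_linear[OF C])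
  have "(\<lambda>n. p (r (r' n))) \<longlonglongrightarrow> (- q - adjoint C yl - 0, d + 0 *\<^sub>R yl)"
    unfolding p_def by (intro tendsto_intros yr er exr adj)
  with \<open>closed D\<close> pD have "(- q - adjoint C yl, d) \<in> D"
    using closed_sequentially[of D "\<lambda>n. p (r (r' n))"] by simp
  then obtain xl w where w: "w \<in> N" and eqs: "- q - adjoint C yl = H xl" "d = C xl - w"
    unfolding D_def by auto
  \<comment> \<open>The vector \<open>w\<close> is normal to the box at every \<open>y (r (r' n))\<close>, hence also at their limit.\<close>
  have "(y' - yl) \<bullet> (C xl - d) \<le> 0" if "y' \<in> ?Y" for y'
  proof (rule LIMSEQ_le_const2)
    show "(\<lambda>n. (y' - y (r (r' n))) \<bullet> (C xl - d)) \<longlonglongrightarrow> (y' - yl) \<bullet> (C xl - d)"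
      by (intro tendsto_intros yr)
    show "\<exists>M. \<forall>n\<ge>M. (y' - y (r (r' n))) \<bullet> (C xl - d) \<le> 0"
      using N w that eqs(2) by auto
  qed
  moreover have "H xl + q + adjoint C yl = 0"
    using eqs(1)[symmetric] by simp
  ultimately show ?thesis using yl(1) by blast
qed

section \<open>Convergence of relaxed alternating directions for monotone relations\<close>

definition monotone_graph :: "('a::real_inner \<times> 'a) set \<Rightarrow> bool" where
  "monotone_graph F \<longleftrightarrow> (\<forall>(x, \<xi>)\<in>F. \<forall>(x', \<xi>')\<in>F. 0 \<le> (x - x') \<bullet> (\<xi> - \<xi>'))"

lemma monotone_graphD:
  "monotone_graph F \<Longrightarrow> (x, \<xi>) \<in> F \<Longrightarrow> (x', \<xi>') \<in> F \<Longrightarrow> 0 \<le> (x - x') \<bullet> (\<xi> - \<xi>')"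
  unfolding monotone_graph_def by blast

text \<open>
  With \<open>a = x - xs\<close>, \<open>c = y - ys\<close> and \<open>e = t - x\<close>, monotonicity of \<open>G\<close> gives \<open>a \<bullet> c \<ge> 0\<close> and monotonicity of
  \<open>F\<close> gives \<open>(a + e) \<bullet> (c + e) \<le> 0\<close>. Together they leave \<open>(a + c) \<bullet> e \<le> - |e|\<^sup>2\<close>, so moving \<open>x + y\<close> by
  \<open>\<alpha> e\<close> with \<open>\<alpha> < 2\<close> does not increase its distance to \<open>xs + ys\<close>.
\<close>

lemma relaxed_admm_fejer:
  fixes F G :: "('a::real_inner \<times> 'a) set"
  assumes mono: "monotone_graph F" "monotone_graph G" and \<alpha>: "0 < \<alpha>"
    and F: "(t, - (y + (t - x))) \<in> F" and G: "(x, y) \<in> G"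
    and upd: "x' + y' = x + y + \<alpha> *\<^sub>R (t - x)"
    and sol: "(xs, - ys) \<in> F" "(xs, ys) \<in> G"
  shows "(norm (x' + y' - (xs + ys)))\<^sup>2
    \<le> (norm (x + y - (xs + ys)))\<^sup>2 - \<alpha> * (2 - \<alpha>) * (norm (t - x))\<^sup>2"
proof -
  define a c e where "a = x - xs" and "c = y - ys" and "e = t - x"
  have ac: "0 \<le> a \<bullet> c"
    using monotone_graphD[OF mono(2) G sol(2)] by (simp add: a_def c_def)
  have "0 \<le> (t - xs) \<bullet> (- (y + (t - x)) - (- ys))"
    using monotone_graphD[OF mono(1) F sol(1)] by simp
  also have "t - xs = a + e" by (simp add: a_def e_def)
  also have "- (y + (t - x)) - (- ys) = - (c + e)" by (simp add: c_def e_def)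
  finally have "a \<bullet> c + (a + c) \<bullet> e + e \<bullet> e \<le> 0"
    unfolding inner_minus_right inner_add_left inner_add_right
    using inner_commute[of e c] by linarith
  with ac have "(a + c) \<bullet> e \<le> - (e \<bullet> e)" by linarith
  then have "2 * \<alpha> * ((a + c) \<bullet> e) \<le> 2 * \<alpha> * (- (e \<bullet> e))"
    using \<alpha> by (intro mult_left_mono) auto
  moreover have "x' + y' - (xs + ys) = (a + c) + \<alpha> *\<^sub>R e" "x + y - (xs + ys) = a + c"
    using upd by (simp_all add: a_def c_def e_def)
  ultimately show ?thesis
    unfolding power2_norm_eq_inner e_def[symmetric]
    by (simp add: inner_add_left inner_add_right inner_commute algebra_simps)
qed

lemma null_of_norm_square_le:
  fixes z :: "nat \<Rightarrow> 'a::real_normed_vector"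
  assumes "u \<longlonglongrightarrow> 0" "\<And>k. (norm (z k))\<^sup>2 \<le> u k"
  shows "z \<longlonglongrightarrow> 0"
proof (rule Lim_null_comparison)
  show "\<forall>\<^sub>F k in sequentially. norm (z k) \<le> sqrt (u k)"
    using assms(2) by (intro always_eventually allI real_le_rsqrt)
  show "(\<lambda>k. sqrt (u k)) \<longlonglongrightarrow> 0"
    using tendsto_real_sqrt[OF assms(1)] by simp
qed

text \<open>
  An Opial type argument in the variable \<open>x + y\<close>. Distances in this variable control \<open>x\<close> and \<open>y\<close>
  separately, because the cross term \<open>(x - xs) \<bullet> (y - ys)\<close> is nonnegative for members of \<open>G\<close>. The index is shifted by one since the arbitrary initial pair \<open>(x 0, y 0)\<close> need not lie in \<open>G\<close>.
\<close>

lemma relaxed_admm_converges_unit_metric: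
  fixes F G :: "('a::euclidean_space \<times> 'a) set"
  assumes mono: "monotone_graph F" "monotone_graph G" and cl: "closed F" "closed G"
    and \<alpha>: "0 < \<alpha>" "\<alpha> < 2"
    and F: "\<And>k. (t (Suc k), - (y k + (t (Suc k) - x k))) \<in> F"
    and G: "\<And>k. (x (Suc k), y (Suc k)) \<in> G"
    and upd: "\<And>k. y (Suc k) = y k + (\<alpha> *\<^sub>R t (Suc k) + (1 - \<alpha>) *\<^sub>R x k - x (Suc k))"
    and sol: "(xs, - ys) \<in> F" "(xs, ys) \<in> G"
  shows "\<exists>xl yl. (xl, - yl) \<in> F \<and> (xl, yl) \<in> G \<and>
    (\<lambda>k. t (Suc k)) \<longlonglongrightarrow> xl \<and> x \<longlonglongrightarrow> xl \<and> y \<longlonglongrightarrow> yl"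
proof -
  define e where "e k = t (Suc (Suc k)) - x (Suc k)" for k
  define V where "V xs ys k = (norm (x (Suc k) + y (Suc k) - (xs + ys)))\<^sup>2" for xs ys k
  have fejer: "V xs ys (Suc k) \<le> V xs ys k - \<alpha> * (2 - \<alpha>) * (norm (e k))\<^sup>2"
    if "(xs, - ys) \<in> F" "(xs, ys) \<in> G" for xs ys k
  proof -
    have "x (Suc (Suc k)) + y (Suc (Suc k)) = x (Suc k) + y (Suc k) + \<alpha> *\<^sub>R (t (Suc (Suc k)) - x (Suc k))"
      unfolding upd[of "Suc k"] by (simp add: algebra_simps)
    from relaxed_admm_fejer[OF mono \<alpha>(1) F G this that] show ?thesis
      by (simp add: V_def e_def)
  qed
  have \<alpha>\<alpha>: "0 < \<alpha> * (2 - \<alpha>)" using \<alpha> by simp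
  have V0: "0 \<le> V xs ys k" for xs ys k by (simp add: V_def)
  have dec: "decseq (V xs ys)" if "(xs, - ys) \<in> F" "(xs, ys) \<in> G" for xs ys
  proof (rule decseq_SucI)
    fix k
    have "0 \<le> \<alpha> * (2 - \<alpha>) * (norm (e k))\<^sup>2" using \<alpha>\<alpha> by simp
    then show "V xs ys (Suc k) \<le> V xs ys k" using fejer[OF that, of k] by linarith
  qed
  have coercive: "(norm (x (Suc k) - xs))\<^sup>2 + (norm (y (Suc k) - ys))\<^sup>2 \<le> V xs ys k"
    if "(xs, ys) \<in> G" for xs ys k
  proof -
    have "0 \<le> (x (Suc k) - xs) \<bullet> (y (Suc k) - ys)"
      using monotone_graphD[OF mono(2) G that] by simp
    moreover have "x (Suc k) + y (Suc k) - (xs + ys) = (x (Suc k) - xs) + (y (Suc k) - ys)" by simp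
    ultimately show ?thesis
      unfolding V_def power2_norm_eq_inner
      by (simp only: inner_add_left inner_add_right inner_commute)
  qed
  have e0: "e \<longlonglongrightarrow> 0"
  proof -
    obtain L where "V xs ys \<longlonglongrightarrow> L"
      by (rule decseq_convergent[OF dec[OF sol], of 0]) (use V0 in auto)
    then have "(\<lambda>k. (V xs ys k - V xs ys (Suc k)) / (\<alpha> * (2 - \<alpha>))) \<longlonglongrightarrow> (L - L) / (\<alpha> * (2 - \<alpha>))"
      using \<alpha>\<alpha> by (intro tendsto_intros LIMSEQ_Suc) auto
    then have "(\<lambda>k. (V xs ys k - V xs ys (Suc k)) / (\<alpha> * (2 - \<alpha>))) \<longlonglongrightarrow> 0" by simp
    moreover have "(norm (e k))\<^sup>2 \<le> (V xs ys k - V xs ys (Suc k)) / (\<alpha> * (2 - \<alpha>))" for k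
      using fejer[OF sol, of k] by (simp add: pos_le_divide_eq[OF \<alpha>\<alpha>] mult.commute)
    ultimately show ?thesis
      by (blast intro: null_of_norm_square_le)
  qed
  have "bounded (range (\<lambda>k. (x (Suc k), y (Suc k))))"
  proof -
    have "norm ((x (Suc k), y (Suc k)) - (xs, ys)) \<le> sqrt (V xs ys 0)" for k
    proof -
      have "(norm (x (Suc k) - xs))\<^sup>2 + (norm (y (Suc k) - ys))\<^sup>2 \<le> V xs ys 0"
        using coercive[OF sol(2), of k] decseqD[OF dec[OF sol], of 0 k] by simp
      then show ?thesis by (simp add: norm_Pair)
    qed
    then have "(x (Suc k), y (Suc k)) \<in> cball (xs, ys) (sqrt (V xs ys 0))" for k
      by (metis dist_norm dist_commute mem_cball)
    then show ?thesis
      by (intro bounded_subset[OF bounded_cball]) auto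
  qed
  then obtain p r where r: "strict_mono (r :: nat \<Rightarrow> nat)"
    and p: "((\<lambda>k. (x (Suc k), y (Suc k))) \<circ> r) \<longlonglongrightarrow> p"
    using bounded_imp_convergent_subsequence by blast
  obtain xl yl where pl: "p = (xl, yl)" by (cases p)
  have xr: "(\<lambda>k. x (Suc (r k))) \<longlonglongrightarrow> xl" and yr: "(\<lambda>k. y (Suc (r k))) \<longlonglongrightarrow> yl"
    using tendsto_fst[OF p] tendsto_snd[OF p] by (simp_all add: pl o_def)
  have er: "(\<lambda>k. e (r k)) \<longlonglongrightarrow> 0"
    using LIMSEQ_subseq_LIMSEQ[OF e0 r] by (simp add: o_def)
  have lG: "(xl, yl) \<in> G"
    by (rule closed_sequentially[OF cl(2), of "\<lambda>k. (x (Suc (r k)), y (Suc (r k)))"])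
       (auto intro: G tendsto_Pair xr yr)
  have "(\<lambda>k. (x (Suc (r k)) + e (r k), - (y (Suc (r k)) + e (r k)))) \<longlonglongrightarrow> (xl + 0, - (yl + 0))"
    by (intro tendsto_intros xr yr er)
  moreover have "(x (Suc (r k)) + e (r k), - (y (Suc (r k)) + e (r k))) \<in> F" for k
    using F[of "Suc (r k)"] by (simp add: e_def)
  ultimately have lF: "(xl, - yl) \<in> F"
    using closed_sequentially[OF cl(1)] by fastforce
  \<comment> \<open>The cluster point is itself a solution, so the distance to it is nonincreasing as well.\<close>
  have "(\<lambda>k. V xl yl (r k)) \<longlonglongrightarrow> (norm (xl + yl - (xl + yl)))\<^sup>2"
    unfolding V_def by (intro tendsto_intros xr yr)
  moreover obtain L where L: "V xl yl \<longlonglongrightarrow> L"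
    by (rule decseq_convergent[OF dec[OF lF lG], of 0]) (use V0 in auto)
  moreover have "(\<lambda>k. V xl yl (r k)) \<longlonglongrightarrow> L"
    using LIMSEQ_subseq_LIMSEQ[OF L r] by (simp add: o_def)
  ultimately have Vl: "V xl yl \<longlonglongrightarrow> 0"
    using LIMSEQ_unique by fastforce
  have lim: "(\<lambda>k. z (Suc k)) \<longlonglongrightarrow> zl"
    if "\<And>k. (norm (z (Suc k) - zl))\<^sup>2 \<le> V xl yl k" for z zl
  proof -
    have "(\<lambda>k. z (Suc k) - zl) \<longlonglongrightarrow> 0"
      by (rule null_of_norm_square_le[OF Vl that])
    then show ?thesis by (simp only: LIM_zero_iff)
  qed
  have "(norm (x (Suc k) - xl))\<^sup>2 \<le> V xl yl k" "(norm (y (Suc k) - yl))\<^sup>2 \<le> V xl yl k" for k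
    using coercive[OF lG, of k] by (smt (verit) zero_le_power2)+
  then have xl: "x \<longlonglongrightarrow> xl" and yl: "y \<longlonglongrightarrow> yl"
    using lim[of x xl] lim[of y yl] by (simp_all add: filterlim_sequentially_Suc)
  have "(\<lambda>k. x (Suc k) + e k) \<longlonglongrightarrow> xl + 0"
    by (intro tendsto_add e0 LIMSEQ_Suc xl)
  then have "(\<lambda>k. t (Suc (Suc k))) \<longlonglongrightarrow> xl" by (simp add: e_def)
  then have "(\<lambda>k. t (Suc k)) \<longlonglongrightarrow> xl"
    using filterlim_sequentially_Suc[of "\<lambda>k. t (Suc k)"] by simp
  with lF lG xl yl show ?thesis by blast
qed

text \<open>
  The metric is \<open>D = Q\<^sup>2\<close> with \<open>Q\<close> symmetric and invertible. Replacing \<open>(x, y)\<close> by \<open>(Q x, R y)\<close> preserves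
  \<open>x \<bullet> y\<close>, hence monotonicity, and turns the iteration into the one for the identity metric.
\<close>

theorem relaxed_admm_converges:
  fixes F G :: "('a::euclidean_space \<times> 'a) set" and Q R :: "'a \<Rightarrow> 'a"
  assumes mono: "monotone_graph F" "monotone_graph G" and cl: "closed F" "closed G"
    and \<alpha>: "0 < \<alpha>" "\<alpha> < 2"
    and Q: "linear Q" "\<And>a b. Q a \<bullet> b = a \<bullet> Q b"
    and R: "linear R" "\<And>a. R (Q a) = a" "\<And>a. Q (R a) = a"
    and F: "\<And>k. (t (Suc k), - (y k + Q (Q (t (Suc k) - x k)))) \<in> F"
    and G: "\<And>k. (x (Suc k), y (Suc k)) \<in> G"
    and upd: "\<And>k. y (Suc k) = y k + Q (Q (\<alpha> *\<^sub>R t (Suc k) + (1 - \<alpha>) *\<^sub>R x k - x (Suc k)))"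
    and sol: "(xs, - ys) \<in> F" "(xs, ys) \<in> G"
  shows "\<exists>xl yl. (xl, - yl) \<in> F \<and> (xl, yl) \<in> G \<and>
    (\<lambda>k. t (Suc k)) \<longlonglongrightarrow> xl \<and> x \<longlonglongrightarrow> xl \<and> y \<longlonglongrightarrow> yl"
proof -
  define tr where "tr E = {(a, b). (R a, Q b) \<in> E}" for E :: "('a \<times> 'a) set"
  note [simp] = linear_add[OF Q(1)] linear_diff[OF Q(1)] linear_neg[OF Q(1)] linear_scale[OF Q(1)]
    linear_add[OF R(1)] linear_diff[OF R(1)] linear_neg[OF R(1)] linear_scale[OF R(1)]
  have cont: "continuous_on UNIV Q" "continuous_on UNIV R"
    using Q R by (simp_all add: linear_continuous_on linear_conv_bounded_linear)
  have Qlim: "(\<lambda>k. Q (f k)) \<longlonglongrightarrow> Q l" and Rlim: "(\<lambda>k. R (f k)) \<longlonglongrightarrow> R l"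
    if "f \<longlonglongrightarrow> l" for f :: "nat \<Rightarrow> 'a" and l
    using that Q(1) R(1) by (simp_all add: bounded_linear.tendsto linear_conv_bounded_linear)
  have mt: "monotone_graph (tr E)" if "monotone_graph E" for E
    unfolding monotone_graph_def tr_def
  proof clarsimp
    fix a b a' b' assume "(R a, Q b) \<in> E" "(R a', Q b') \<in> E"
    then have "0 \<le> (R a - R a') \<bullet> (Q b - Q b')"
      using monotone_graphD[OF that] by blast
    also have "\<dots> = R (a - a') \<bullet> Q (b - b')" by simp
    also have "\<dots> = Q (R (a - a')) \<bullet> (b - b')" by (rule Q(2)[symmetric])
    finally show "0 \<le> (a - a') \<bullet> (b - b')" by (simp add: R)
  qed
  have ct: "closed (tr E)" if "closed E" for E
  proof -
    have "closed ((\<lambda>p. (R (fst p), Q (snd p))) -` E)"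
      by (intro closed_vimage that continuous_intros continuous_on_compose2[OF cont(1)]
          continuous_on_compose2[OF cont(2)]) auto
    moreover have "tr E = (\<lambda>p. (R (fst p), Q (snd p))) -` E" by (auto simp: tr_def)
    ultimately show ?thesis by simp
  qed
  have "\<exists>xl yl. (xl, - yl) \<in> tr F \<and> (xl, yl) \<in> tr G \<and>
    (\<lambda>k. Q (t (Suc k))) \<longlonglongrightarrow> xl \<and> (\<lambda>k. Q (x k)) \<longlonglongrightarrow> xl \<and> (\<lambda>k. R (y k)) \<longlonglongrightarrow> yl"
  proof (rule relaxed_admm_converges_unit_metric[OF mt mt ct ct \<alpha>, of F G "\<lambda>k. Q (t k)" "\<lambda>k. R (y k)"
        "\<lambda>k. Q (x k)" "Q xs" "R ys"])
    fix k
    show "(Q (t (Suc k)), - (R (y k) + (Q (t (Suc k)) - Q (x k)))) \<in> tr F"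
      using F[of k] by (simp add: tr_def R)
    show "(Q (x (Suc k)), R (y (Suc k))) \<in> tr G"
      using G[of k] by (simp add: tr_def R)
    show "R (y (Suc k)) = R (y k) + (\<alpha> *\<^sub>R Q (t (Suc k)) + (1 - \<alpha>) *\<^sub>R Q (x k) - Q (x (Suc k)))"
      unfolding upd[of k] by (simp add: R)
    show "(Q xs, - R ys) \<in> tr F" "(Q xs, R ys) \<in> tr G"
      using sol by (simp_all add: tr_def R)
  qed (use mono cl in auto)
  then obtain xl yl where l: "(xl, - yl) \<in> tr F" "(xl, yl) \<in> tr G"
    "(\<lambda>k. Q (t (Suc k))) \<longlonglongrightarrow> xl" "(\<lambda>k. Q (x k)) \<longlonglongrightarrow> xl" "(\<lambda>k. R (y k)) \<longlonglongrightarrow> yl"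
    by blast
  have "(R xl, - Q yl) \<in> F" "(R xl, Q yl) \<in> G"
    using l(1,2) by (simp_all add: tr_def)
  moreover have "(\<lambda>k. t (Suc k)) \<longlonglongrightarrow> R xl" "x \<longlonglongrightarrow> R xl" "y \<longlonglongrightarrow> Q yl"
    using Rlim[OF l(3)] Rlim[OF l(4)] Qlim[OF l(5)] by (simp_all add: R)
  ultimately show ?thesis by blast
qed

section \<open>Subdifferentials and saddle points\<close>

text \<open>
  The subdifferential of the convex function that equals \<open>\<phi>\<close> on \<open>S\<close> and is infinite elsewhere. Keeping the
  domain separate from a real-valued \<open>\<phi>\<close> avoids arithmetic with infinities.
\<close>

definition subgradient_graph :: "'a::real_inner set \<Rightarrow> ('a \<Rightarrow> real) \<Rightarrow> ('a \<times> 'a) set" where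
  "subgradient_graph S \<phi> = {(x, \<xi>). x \<in> S \<and> (\<forall>x'\<in>S. \<phi> x + \<xi> \<bullet> (x' - x) \<le> \<phi> x')}"

lemma monotone_subgradient_graph: "monotone_graph (subgradient_graph S \<phi>)"
  unfolding monotone_graph_def subgradient_graph_def
proof clarsimp
  fix x \<xi> x' \<xi>'
  assume "x \<in> S" "\<forall>z\<in>S. \<phi> x + \<xi> \<bullet> (z - x) \<le> \<phi> z" "x' \<in> S" "\<forall>z\<in>S. \<phi> x' + \<xi>' \<bullet> (z - x') \<le> \<phi> z"
  then have "\<phi> x + \<xi> \<bullet> (x' - x) \<le> \<phi> x'" "\<phi> x' + \<xi>' \<bullet> (x - x') \<le> \<phi> x" by auto
  then show "0 \<le> (x - x') \<bullet> (\<xi> - \<xi>')"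
    by (simp add: inner_diff_left inner_diff_right inner_commute)
qed

lemma closed_subgradient_graph:
  assumes "closed S" "continuous_on S \<phi>"
  shows "closed (subgradient_graph S \<phi>)"
  unfolding closed_sequential_limits
proof clarify
  fix p x \<xi> assume p: "\<forall>n. p n \<in> subgradient_graph S \<phi>" "p \<longlonglongrightarrow> (x, \<xi>)"
  have lim: "(\<lambda>n. fst (p n)) \<longlonglongrightarrow> x" "(\<lambda>n. snd (p n)) \<longlonglongrightarrow> \<xi>"
    using tendsto_fst[OF p(2)] tendsto_snd[OF p(2)] by simp_all
  have S: "fst (p n) \<in> S" and sub: "z \<in> S \<Longrightarrow> \<phi> (fst (p n)) + snd (p n) \<bullet> (z - fst (p n)) \<le> \<phi> z" for n z
    using p(1)[rule_format, of n] by (auto simp: subgradient_graph_def)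
  have x: "x \<in> S" using closed_sequentially[OF assms(1) _ lim(1)] S by blast
  have "(\<lambda>n. \<phi> (fst (p n))) \<longlonglongrightarrow> \<phi> x"
    using continuous_on_tendsto_compose[OF assms(2) lim(1) x] S by simp
  then have bound_lim: "(\<lambda>n. \<phi> (fst (p n)) + snd (p n) \<bullet> (z - fst (p n))) \<longlonglongrightarrow> \<phi> x + \<xi> \<bullet> (z - x)" for z
    by (intro tendsto_intros lim)
  have "\<phi> x + \<xi> \<bullet> (z - x) \<le> \<phi> z" if "z \<in> S" for z
    by (rule LIMSEQ_le_const2[OF bound_lim[of z]]) (simp add: sub[OF that])
  with x show "(x, \<xi>) \<in> subgradient_graph S \<phi>" by (simp add: subgradient_graph_def)
qed

text \<open>
  Since both primal points are \<open>x\<close>, the bilinear term vanishes there for every multiplier. The other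
  inequality is the sum of the two subgradient inequalities.
\<close>

lemma saddle_point_of_subgradients:
  assumes f: "\<And>x. f x = (if x \<in> S then ereal (\<phi> x) else \<infinity>)"
    and g: "\<And>x. g x = (if x \<in> T then ereal (\<psi> x) else \<infinity>)"
    and sub: "(x, - y) \<in> subgradient_graph S \<phi>" "(x, y) \<in> subgradient_graph T \<psi>"
  shows "saddle_point (lagrangian f g) x x y"
  unfolding saddle_point_def
proof (intro allI conjI)
  fix x1 x2 y'
  show "lagrangian f g x x y' \<le> lagrangian f g x x y" by (simp add: lagrangian_def)
  have x: "x \<in> S" "x \<in> T" using sub by (auto simp: subgradient_graph_def)
  show "lagrangian f g x x y \<le> lagrangian f g x1 x2 y"
  proof (cases "x1 \<in> S \<and> x2 \<in> T")
    case True
    then have "\<phi> x - y \<bullet> (x1 - x) \<le> \<phi> x1" "\<psi> x + y \<bullet> (x2 - x) \<le> \<psi> x2"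
      using sub by (auto simp: subgradient_graph_def)
    then show ?thesis
      using True x by (simp add: lagrangian_def f g inner_diff_right)
  next
    case False
    then show ?thesis by (auto simp: lagrangian_def f g)
  qed
qed

section \<open>Subgradients of the split problem\<close>

definition split_f_dom ::
  "real^'n^'m \<Rightarrow> real^'m \<Rightarrow> real^'n^'p \<Rightarrow> real^'p \<Rightarrow> ('n, 'm, 'p) split_vec set" where
  "split_f_dom G h A b = {(x, s, zI, zE). zI = G *v x + s - h \<and> zE = A *v x - b}"

definition split_f_val :: "real^'n^'n \<Rightarrow> real^'n \<Rightarrow> ('n, 'm::finite, 'p::finite) split_vec \<Rightarrow> real" where
  "split_f_val P q = (\<lambda>(x, s, zI, zE). 1/2 * (x \<bullet> (P *v x)) + q \<bullet> x)"

definition split_g_dom :: "('n::finite, 'm::finite, 'p::finite) split_vec set" where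
  "split_g_dom = {(x, s, zI, zE). 0 \<le> s}"

definition split_g_val :: "real \<Rightarrow> real \<Rightarrow> ('n::finite, 'm::finite, 'p::finite) split_vec \<Rightarrow> real" where
  "split_g_val \<mu>I \<mu>E = (\<lambda>(x, s, zI, zE). \<mu>I * norm1 zI + \<mu>E * norm1 zE)"

lemma split_f_eq:
  "split_f P q G h A b v = (if v \<in> split_f_dom G h A b then ereal (split_f_val P q v) else \<infinity>)"
  by (cases v) (simp add: split_f_dom_def split_f_val_def)

lemma split_g_eq:
  "split_g \<mu>I \<mu>E v = (if v \<in> split_g_dom then ereal (split_g_val \<mu>I \<mu>E v) else \<infinity>)"
  by (cases v) (simp add: split_g_dom_def split_g_val_def)

lemma continuous_on_matrix_vector_mult [continuous_intros]:
  fixes M :: "real^'a^'b"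
  shows "continuous_on S f \<Longrightarrow> continuous_on S (\<lambda>v. M *v f v)"
  by (rule continuous_on_compose2[of UNIV "\<lambda>x. M *v x"])
     (auto intro: linear_continuous_on matrix_vector_mul_bounded_linear)

lemma closed_split_f_subgradient:
  "closed (subgradient_graph (split_f_dom G h A b) (split_f_val P q))"
proof (rule closed_subgradient_graph)
  have "split_f_dom G h A b = {v. fst (snd (snd v)) = G *v fst v + fst (snd v) - h} \<inter>
      {v. snd (snd (snd v)) = A *v fst v - b}"
    by (auto simp: split_f_dom_def)
  then show "closed (split_f_dom G h A b)"
    by (auto intro!: closed_Int closed_Collect_eq continuous_intros)
  show "continuous_on (split_f_dom G h A b) (split_f_val P q)"
    unfolding split_f_val_def split_def by (intro continuous_intros)
qed

lemma closed_split_g_subgradient: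
  "closed (subgradient_graph (split_g_dom :: ('n::finite, 'm::finite, 'p::finite) split_vec set) (split_g_val \<mu>I \<mu>E))"
proof (rule closed_subgradient_graph)
  have eq: "split_g_dom = (\<Inter>i. {v :: ('n, 'm, 'p) split_vec. 0 \<le> fst (snd v) $ i})"
    by (auto simp: split_g_dom_def less_eq_vec_def)
  show "closed (split_g_dom :: ('n, 'm, 'p) split_vec set)"
    unfolding eq by (intro closed_INT ballI closed_Collect_le continuous_intros)
  show "continuous_on split_g_dom (split_g_val \<mu>I \<mu>E :: ('n, 'm, 'p) split_vec \<Rightarrow> real)"
    unfolding split_g_val_def split_def norm1_def by (intro continuous_intros)
qed

lemma pos_semidef_quadratic_subgradient:
  assumes "pos_semidef P"
  shows "1/2 * (x \<bullet> (P *v x)) + q \<bullet> x + (P *v x + q) \<bullet> (x' - x) \<le> 1/2 * (x' \<bullet> (P *v x')) + q \<bullet> x'"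
proof -
  define d where "d = x' - x"
  have x': "x' = x + d" by (simp add: d_def)
  have "(P *v x) \<bullet> d = x \<bullet> (P *v d)"
    using assms unfolding pos_semidef_def by (metis dot_lmul_matrix transpose_matrix_vector)
  moreover have "0 \<le> d \<bullet> (P *v d)" using assms by (simp add: pos_semidef_def)
  ultimately show ?thesis
    unfolding d_def[symmetric] x'
    by (simp add: matrix_vector_right_distrib inner_add_left inner_add_right inner_commute algebra_simps)
qed

lemma transpose_inner: "(transpose M *v y) \<bullet> x = y \<bullet> (M *v x)" for M :: "real^'a^'b"
  by (simp add: transpose_matrix_vector dot_lmul_matrix)

text \<open>
  The vectors \<open>\<nu>I\<close> and \<open>\<nu>E\<close> are the multipliers of the two affine constraints that define the domain; they
  are also the unknowns of the linear system of the algorithm.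
\<close>

lemma split_f_subgradient:
  assumes P: "pos_semidef P" and dom: "(x, s, zI, zE) \<in> split_f_dom G h A b"
    and stat: "P *v x + q + transpose G *v \<nu>I + transpose A *v \<nu>E = \<xi>"
  shows "((x, s, zI, zE), (\<xi>, \<nu>I, - \<nu>I, - \<nu>E)) \<in> subgradient_graph (split_f_dom G h A b) (split_f_val P q)"
  unfolding subgradient_graph_def
proof (clarify, intro conjI dom ballI)
  fix v assume v: "v \<in> split_f_dom G h A b"
  obtain x' s' zI' zE' where veq: "v = (x', s', zI', zE')" by (cases v)
  have "zI' - zI = G *v (x' - x) + (s' - s)" "zE' - zE = A *v (x' - x)"
    using v dom by (auto simp: veq split_f_dom_def matrix_vector_mult_diff_distrib)
  then have "(\<xi>, \<nu>I, - \<nu>I, - \<nu>E) \<bullet> (v - (x, s, zI, zE))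
      = \<xi> \<bullet> (x' - x) - \<nu>I \<bullet> (G *v (x' - x)) - \<nu>E \<bullet> (A *v (x' - x))"
    by (simp add: veq inner_add_right)
  also have "\<dots> = (P *v x + q) \<bullet> (x' - x)"
    by (simp add: stat[symmetric] inner_add_left transpose_inner del: transpose_matrix_vector)
  finally show "split_f_val P q (x, s, zI, zE) + (\<xi>, \<nu>I, - \<nu>I, - \<nu>E) \<bullet> (v - (x, s, zI, zE)) \<le> split_f_val P q v"
    using pos_semidef_quadratic_subgradient[OF P, of x q x'] by (simp add: split_f_val_def veq)
qed

text \<open>
  The function \<open>g\<close> is separable, so the condition splits into blocks. The block of \<open>x\<close> is constant,
  which is why its multiplier is zero.
\<close>

lemma split_g_subgradient:
  fixes x :: "real^'n" and s zI :: "real^'m" and zE :: "real^'p"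
  assumes "0 \<le> s" "\<And>s'. 0 \<le> s' \<Longrightarrow> ws \<bullet> (s' - s) \<le> 0"
    and "\<And>z. \<mu>I * norm1 zI + yI \<bullet> (z - zI) \<le> \<mu>I * norm1 z"
    and "\<And>z. \<mu>E * norm1 zE + yE \<bullet> (z - zE) \<le> \<mu>E * norm1 z"
  shows "((x, s, zI, zE), (0, ws, yI, yE)) \<in> subgradient_graph split_g_dom (split_g_val \<mu>I \<mu>E)"
  unfolding subgradient_graph_def
proof (clarify, intro conjI ballI)
  show "(x, s, zI, zE) \<in> split_g_dom" using assms(1) by (simp add: split_g_dom_def)
  fix v :: "('n, 'm, 'p) split_vec" assume v: "v \<in> split_g_dom"
  obtain x' s' zI' zE' where veq: "v = (x', s', zI', zE')" by (cases v)
  have "ws \<bullet> (s' - s) \<le> 0" using v assms(2) by (simp add: veq split_g_dom_def)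
  then show "split_g_val \<mu>I \<mu>E (x, s, zI, zE) + (0, ws, yI, yE) \<bullet> (v - (x, s, zI, zE)) \<le> split_g_val \<mu>I \<mu>E v"
    using assms(3)[of zI'] assms(4)[of zE'] by (simp add: split_g_val_def veq)
qed

section \<open>Existence of a primal-dual solution\<close>

lemma pos_part_nonneg: "0 \<le> pos_part v"
  by (simp add: pos_part_def less_eq_vec_def)

text \<open>
  Minimizing the penalty \<open>\<mu>I |v + s|\<^sub>1 + \<mu>E |w|\<^sub>1\<close> over \<open>s \<ge> 0\<close> leaves \<open>\<mu>I |pos_part v|\<^sub>1 + \<mu>E |w|\<^sub>1\<close>, which is
  the support function of this box at \<open>(v, w)\<close>.
\<close>

definition multiplier_box :: "real \<Rightarrow> real \<Rightarrow> ((real^'m) \<times> (real^'p)) set" where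
  "multiplier_box \<mu>I \<mu>E = cbox (0, \<chi> i. - \<mu>E) (\<chi> i. \<mu>I, \<chi> i. \<mu>E)"

lemma mem_multiplier_box:
  "(y, y') \<in> multiplier_box \<mu>I \<mu>E \<longleftrightarrow> (\<forall>i. 0 \<le> y $ i \<and> y $ i \<le> \<mu>I) \<and> (\<forall>i. \<bar>y' $ i\<bar> \<le> \<mu>E)"
  by (auto simp: multiplier_box_def cbox_Pair_eq mem_box_cart abs_le_iff minus_le_iff)

lemma multiplier_box_attains_penalty:
  assumes "0 < \<mu>I" "0 < \<mu>E"
  shows "\<exists>y\<in>multiplier_box \<mu>I \<mu>E. y \<bullet> (v, w) = \<mu>I * norm1 (pos_part v) + \<mu>E * norm1 w"
proof
  let ?y = "(\<chi> i. if v $ i > 0 then \<mu>I else 0, \<chi> i. \<mu>E * sgn (w $ i))"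
  show "?y \<in> multiplier_box \<mu>I \<mu>E"
    using assms by (auto simp: mem_multiplier_box abs_mult abs_sgn_eq)
  have "(\<chi> i. if v $ i > 0 then \<mu>I else 0) \<bullet> v = \<mu>I * norm1 (pos_part v)"
    unfolding inner_vec_def norm1_def pos_part_def sum_distrib_left
    by (intro sum.cong) auto
  moreover have "(\<chi> i. \<mu>E * sgn (w $ i)) \<bullet> w = \<mu>E * norm1 w"
    unfolding inner_vec_def norm1_def sum_distrib_left
    by (intro sum.cong) (auto simp: abs_sgn mult.commute)
  ultimately show "?y \<bullet> (v, w) = \<mu>I * norm1 (pos_part v) + \<mu>E * norm1 w" by simp
qed

lemma multiplier_le_penalty:
  "(\<And>i. \<bar>y $ i\<bar> \<le> \<mu>) \<Longrightarrow> y \<bullet> z \<le> \<mu> * norm1 z"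
  unfolding inner_vec_def norm1_def sum_distrib_left
proof (rule sum_mono)
  fix i assume y: "\<And>i. \<bar>y $ i\<bar> \<le> \<mu>"
  have "y $ i * z $ i \<le> \<bar>y $ i\<bar> * \<bar>z $ i\<bar>" by (metis abs_ge_self abs_mult)
  also have "\<dots> \<le> \<mu> * \<bar>z $ i\<bar>" using y by (intro mult_right_mono) auto
  finally show "inner (y $ i) (z $ i) \<le> \<mu> * \<bar>z $ i\<bar>" by simp
qed

text \<open>
  The abstract existence result yields \<open>x\<close> and multipliers \<open>(yI, yE)\<close> in the box. The optimal slack is
  \<open>s = pos_part (h - G x)\<close>, with multiplier \<open>- yI\<close> because stationarity of \<open>f\<close> in its slack couples the two.
  Optimality of \<open>(yI, yE)\<close> on the box forces \<open>yI \<bullet> s = 0\<close> and equality in both penalty estimates.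
\<close>

lemma split_kkt_exists:
  fixes P :: "real^'n^'n" and G :: "real^'n^'m" and A :: "real^'n^'p"
  assumes P: "pos_semidef P" and \<mu>: "\<mu>I > 0" "\<mu>E > 0"
    and bdd: "bdd_below {relaxed_objective P q G h A b \<mu>I \<mu>E x s |x s. 0 \<le> s}"
  shows "\<exists>x y. (x, - y) \<in> subgradient_graph (split_f_dom G h A b) (split_f_val P q) \<and>
    (x, y) \<in> subgradient_graph split_g_dom (split_g_val \<mu>I \<mu>E)"
proof -
  define C where "C x = (G *v x, A *v x)" for x
  have C: "linear C"
    unfolding C_def by (rule linearI) (simp_all add: matrix_vector_right_distrib matrix_vector_mult_scaleR)
  have adj: "adjoint C (y, y') = transpose G *v y + transpose A *v y'" for y y'
  proof (rule vector_eq_rdot[THEN iffD1], rule allI)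
    fix x show "adjoint C (y, y') \<bullet> x = (transpose G *v y + transpose A *v y') \<bullet> x"
      by (simp add: adjoint_works[OF C] adjoint_clauses[OF C] C_def inner_add_left transpose_inner del: transpose_matrix_vector)
  qed
  obtain B where B: "\<And>x s. 0 \<le> s \<Longrightarrow> B \<le> relaxed_objective P q G h A b \<mu>I \<mu>E x s"
    using bdd unfolding bdd_below_def by blast
  have slack: "v + pos_part (- v) = pos_part v" for v :: "real^'m"
    by (simp add: pos_part_def vec_eq_iff max_def)
  have bound: "\<exists>y\<in>multiplier_box \<mu>I \<mu>E. B \<le> 1/2 * (x \<bullet> (P *v x)) + q \<bullet> x + y \<bullet> (C x - (h, b))" for x
  proof -
    have "G *v x + pos_part (- (G *v x - h)) - h = pos_part (G *v x - h)"
      using slack[of "G *v x - h"] by (simp add: algebra_simps)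
    then have "relaxed_objective P q G h A b \<mu>I \<mu>E x (pos_part (- (G *v x - h)))
        = 1/2 * (x \<bullet> (P *v x)) + q \<bullet> x + (\<mu>I * norm1 (pos_part (G *v x - h)) + \<mu>E * norm1 (A *v x - b))"
      by (simp only: relaxed_objective_def add.assoc)
    moreover obtain y where "y \<in> multiplier_box \<mu>I \<mu>E"
      "y \<bullet> (C x - (h, b)) = \<mu>I * norm1 (pos_part (G *v x - h)) + \<mu>E * norm1 (A *v x - b)"
      using multiplier_box_attains_penalty[OF \<mu>, of "G *v x - h" "A *v x - b"]
      by (auto simp: C_def)
    ultimately show ?thesis
      using B[OF pos_part_nonneg, of x "- (G *v x - h)"] by metis
  qed
  have "\<exists>x. \<exists>y\<in>multiplier_box \<mu>I \<mu>E. P *v x + q + adjoint C y = 0 \<and>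
      (\<forall>y'\<in>multiplier_box \<mu>I \<mu>E. (y' - y) \<bullet> (C x - (h, b)) \<le> 0)"
    using kkt_exists_of_bounded_below[OF matrix_vector_mul_linear _ C bound[unfolded multiplier_box_def]] P
    unfolding multiplier_box_def pos_semidef_def by blast
  then obtain x yI yE where box: "(yI, yE) \<in> multiplier_box \<mu>I \<mu>E"
    and stat: "P *v x + q + adjoint C (yI, yE) = 0"
    and opt: "\<And>y'. y' \<in> multiplier_box \<mu>I \<mu>E \<Longrightarrow> (y' - (yI, yE)) \<bullet> (C x - (h, b)) \<le> 0"
    by (metis surj_pair)
  define v w where "v = G *v x - h" and "w = A *v x - b"
  define s where "s = pos_part (- v)"
  have zI: "pos_part v = G *v x + s - h"
    using slack[of v] by (simp add: s_def v_def algebra_simps)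
  have "((x, s, pos_part v, w), (0, yI, - yI, - yE)) \<in> subgradient_graph (split_f_dom G h A b) (split_f_val P q)"
    by (rule split_f_subgradient[OF P])
       (use zI stat in \<open>simp_all add: split_f_dom_def w_def adj add.assoc\<close>)
  moreover have "((x, s, pos_part v, w), (0, - yI, yI, yE)) \<in> subgradient_graph split_g_dom (split_g_val \<mu>I \<mu>E)"
  proof -
    have yI: "0 \<le> yI $ i" "\<bar>yI $ i\<bar> \<le> \<mu>I" for i
      using box by (auto simp: mem_multiplier_box)
    have yE: "\<bar>yE $ i\<bar> \<le> \<mu>E" for i
      using box by (auto simp: mem_multiplier_box)
    have nn: "0 \<le> yI \<bullet> r" if "0 \<le> r" for r
      unfolding inner_vec_def using yI that by (intro sum_nonneg) (auto simp: less_eq_vec_def)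
    have vw: "C x - (h, b) = (v, w)" by (simp add: C_def v_def w_def)
    obtain y where "y \<in> multiplier_box \<mu>I \<mu>E"
      and "y \<bullet> (v, w) = \<mu>I * norm1 (pos_part v) + \<mu>E * norm1 w"
      using multiplier_box_attains_penalty[OF \<mu>] by blast
    then have "\<mu>I * norm1 (pos_part v) + \<mu>E * norm1 w \<le> yI \<bullet> v + yE \<bullet> w"
      using opt[of y] by (simp add: vw inner_diff_left)
    moreover have "yI \<bullet> v = yI \<bullet> pos_part v - yI \<bullet> s"
      unfolding slack[of v, folded s_def, symmetric] by (simp add: inner_add_right)
    moreover have "0 \<le> yI \<bullet> s" unfolding s_def by (intro nn pos_part_nonneg)
    moreover have "yI \<bullet> pos_part v \<le> \<mu>I * norm1 (pos_part v)" "yE \<bullet> w \<le> \<mu>E * norm1 w"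
      using yI yE by (auto intro: multiplier_le_penalty)
    \<comment> \<open>The lower bound for \<open>yI \<bullet> v + yE \<bullet> w\<close> meets the sum of the upper bounds, so all are equalities.\<close>
    ultimately have eqs: "yI \<bullet> s = 0" "yI \<bullet> pos_part v = \<mu>I * norm1 (pos_part v)" "yE \<bullet> w = \<mu>E * norm1 w"
      by simp_all
    show ?thesis
    proof (rule split_g_subgradient)
      show "0 \<le> s" unfolding s_def by (rule pos_part_nonneg)
      show "- yI \<bullet> (s' - s) \<le> 0" if "0 \<le> s'" for s'
        using nn[OF that] eqs by (simp add: inner_diff_right)
      show "\<mu>I * norm1 (pos_part v) + yI \<bullet> (z - pos_part v) \<le> \<mu>I * norm1 z" for z
        using multiplier_le_penalty[OF yI(2), of z] eqs by (simp add: inner_diff_right)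
      show "\<mu>E * norm1 w + yE \<bullet> (z - w) \<le> \<mu>E * norm1 z" for z
        using multiplier_le_penalty[OF yE, of z] eqs by (simp add: inner_diff_right)
    qed
  qed
  ultimately show ?thesis
    by (intro exI[of _ "(x, s, pos_part v, w)"] exI[of _ "(0, - yI, yI, yE)"]) simp
qed

section \<open>The iteration as alternating directions\<close>

text \<open>
  Soft thresholding is the proximal map of \<open>(\<mu> / \<rho>) |.|\<^sub>1\<close>, so \<open>v - t\<close> is a subgradient at its value \<open>t\<close>. In a
  coordinate where \<open>|v| > \<mu> / \<rho>\<close> the residual is \<open>\<plusminus> \<mu> / \<rho>\<close> with the sign of \<open>t\<close>; elsewhere \<open>t = 0\<close> and the
  residual is bounded by \<open>\<mu> / \<rho>\<close>.
\<close>

lemma soft_threshold_subgradient: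
  fixes v z :: "real^'k"
  assumes "0 < \<rho>" "0 < \<mu>"
  defines "t \<equiv> soft_threshold (\<mu> / \<rho>) v"
  shows "\<mu> * norm1 t + (\<rho> *\<^sub>R (v - t)) \<bullet> (z - t) \<le> \<mu> * norm1 z"
proof -
  define \<kappa> where "\<kappa> = \<mu> / \<rho>"
  have \<kappa>: "0 < \<kappa>" and \<mu>: "\<mu> = \<rho> * \<kappa>" using assms(1,2) by (auto simp: \<kappa>_def)
  have "\<mu> * \<bar>t $ i\<bar> + \<rho> * (v $ i - t $ i) * (z $ i - t $ i) \<le> \<mu> * \<bar>z $ i\<bar>" for i
  proof -
    have t: "t $ i = max (v $ i - \<kappa>) 0 - max (- (v $ i) - \<kappa>) 0"
      by (simp add: t_def soft_threshold_def \<kappa>_def)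
    have "\<kappa> * \<bar>t $ i\<bar> + (v $ i - t $ i) * (z $ i - t $ i) \<le> \<kappa> * \<bar>z $ i\<bar>"
    proof -
      consider "v $ i > \<kappa>" | "v $ i < - \<kappa>" | "\<bar>v $ i\<bar> \<le> \<kappa>" by linarith
      then show ?thesis
      proof cases
        case 1
        then have vt: "v $ i - t $ i = \<kappa>" "\<bar>t $ i\<bar> = t $ i" using \<kappa> by (auto simp: t)
        show ?thesis unfolding vt using mult_left_mono[OF abs_ge_self[of "z $ i"], of \<kappa>] \<kappa>
          by (simp add: algebra_simps)
      next
        case 2
        then have vt: "v $ i - t $ i = - \<kappa>" "\<bar>t $ i\<bar> = - (t $ i)" using \<kappa> by (auto simp: t)
        show ?thesis unfolding vt using mult_left_mono[OF abs_ge_minus_self[of "z $ i"], of \<kappa>] \<kappa>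
          by (simp add: algebra_simps)
      next
        case 3
        then have t0: "t $ i = 0" by (auto simp: t)
        have "v $ i * z $ i \<le> \<bar>v $ i\<bar> * \<bar>z $ i\<bar>" by (metis abs_ge_self abs_mult)
        also have "\<dots> \<le> \<kappa> * \<bar>z $ i\<bar>" using 3 by (intro mult_right_mono) auto
        finally show ?thesis by (simp add: t0)
      qed
    qed
    then have "\<rho> * (\<kappa> * \<bar>t $ i\<bar> + (v $ i - t $ i) * (z $ i - t $ i)) \<le> \<rho> * (\<kappa> * \<bar>z $ i\<bar>)"
      using assms(1) by (intro mult_left_mono) auto
    then show ?thesis by (simp add: \<mu> algebra_simps)
  qed
  then have "(\<Sum>i\<in>UNIV. \<mu> * \<bar>t $ i\<bar> + \<rho> * (v $ i - t $ i) * (z $ i - t $ i)) \<le> (\<Sum>i\<in>UNIV. \<mu> * \<bar>z $ i\<bar>)"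
    by (intro sum_mono)
  then show ?thesis
    by (simp add: norm1_def inner_vec_def sum.distrib sum_distrib_left mult.assoc)
qed

lemma pos_part_normal:
  fixes v s :: "real^'k"
  assumes "0 < \<sigma>" "0 \<le> s"
  shows "(\<sigma> *\<^sub>R (v - pos_part v)) \<bullet> (s - pos_part v) \<le> 0"
proof -
  have "(v $ i - max (v $ i) 0) * (s $ i - max (v $ i) 0) \<le> 0" for i
  proof -
    have "0 \<le> s $ i" using assms(2) by (simp add: less_eq_vec_def)
    then show ?thesis by (cases "v $ i \<ge> 0") (auto simp: mult_nonpos_nonneg)
  qed
  then have "(v - pos_part v) \<bullet> (s - pos_part v) \<le> 0"
    unfolding inner_vec_def pos_part_def by (intro sum_nonpos) simp
  then show ?thesis
    using assms(1) by (simp add: mult_le_0_iff)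
qed

definition split_scale ::
  "real \<Rightarrow> real \<Rightarrow> real \<Rightarrow> real \<Rightarrow> ('n::finite, 'm::finite, 'p::finite) split_vec \<Rightarrow> ('n, 'm, 'p) split_vec" where
  "split_scale a b c d = (\<lambda>(x, s, zI, zE). (a *\<^sub>R x, b *\<^sub>R s, c *\<^sub>R zI, d *\<^sub>R zE))"

lemma linear_split_scale: "linear (split_scale a b c d)"
  by (rule linearI) (auto simp: split_scale_def split_def scaleR_add_right)

lemma split_scale_self_adjoint:
  "split_scale a b c d v \<bullet> w = v \<bullet> split_scale a b c d w"
  by (cases v; cases w) (simp add: split_scale_def)

lemma split_scale_split_scale:
  "split_scale a b c d (split_scale a' b' c' d' v) = split_scale (a * a') (b * b') (c * c') (d * d') v"
  by (cases v) (simp add: split_scale_def)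

lemma split_scale_one: "split_scale 1 1 1 1 v = v"
  by (cases v) (simp add: split_scale_def)

text \<open>
  The linear system and the updates of \<open>st\<close>, \<open>ztI\<close>, \<open>ztE\<close> are the optimality conditions of the proximal
  step for \<open>f\<close>, whose subgradient at \<open>Xt\<close> is \<open>(- \<sigma>x (xt - x), \<nu>I, - \<nu>I, - \<nu>E)\<close>. The multiplier update makes
  \<open>W'\<close> the residual, scaled by the metric, of the proximal step for \<open>g\<close>. In the \<open>x\<close> block that step is
  the identity, so its residual, the first component of the full multiplier, stays zero.
\<close>

lemma flexqp_step_admm:
  fixes P :: "real^'n^'n" and G :: "real^'n^'m" and A :: "real^'n^'p"
  assumes P: "pos_semidef P" and \<mu>: "\<mu>I > 0" "\<mu>E > 0"
    and pos: "\<sigma>x > 0" "\<sigma>s > 0" "\<rho>I > 0" "\<rho>E > 0"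
    and step: "flexqp_step P q G h A b \<mu>I \<mu>E \<sigma>x \<sigma>s \<rho>I \<rho>E \<alpha> X W Xt X' W'"
  shows "(Xt, - ((0, W) + split_scale \<sigma>x \<sigma>s \<rho>I \<rho>E (Xt - X)))
      \<in> subgradient_graph (split_f_dom G h A b) (split_f_val P q)" (is ?F)
    and "(X', (0, W')) \<in> subgradient_graph split_g_dom (split_g_val \<mu>I \<mu>E)" (is ?G)
    and "(0, W') = (0, W) + split_scale \<sigma>x \<sigma>s \<rho>I \<rho>E (\<alpha> *\<^sub>R Xt + (1 - \<alpha>) *\<^sub>R X - X')" (is ?U)
proof -
  obtain x s zI zE where X: "X = (x, s, zI, zE)" by (cases X)
  obtain ws yI yE where W: "W = (ws, yI, yE)" by (cases W)
  obtain xt st ztI ztE where Xt: "Xt = (xt, st, ztI, ztE)" by (cases Xt)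
  obtain x' s' zI' zE' where X': "X' = (x', s', zI', zE')" by (cases X')
  obtain ws' yI' yE' where W': "W' = (ws', yI', yE')" by (cases W')
  obtain \<nu>I \<nu>E where
    row1: "(P + \<sigma>x *\<^sub>R mat 1) *v xt + transpose G *v \<nu>I + transpose A *v \<nu>E = \<sigma>x *\<^sub>R x - q"
    and row2: "G *v xt - (inverse \<sigma>s + inverse \<rho>I) *\<^sub>R \<nu>I
       = h - s + inverse \<sigma>s *\<^sub>R ws + zI - inverse \<rho>I *\<^sub>R yI"
    and row3: "A *v xt - inverse \<rho>E *\<^sub>R \<nu>E = b + zE - inverse \<rho>E *\<^sub>R yE"
    and st: "st = s - inverse \<sigma>s *\<^sub>R ws - inverse \<sigma>s *\<^sub>R \<nu>I"
    and ztI: "ztI = zI - inverse \<rho>I *\<^sub>R yI + inverse \<rho>I *\<^sub>R \<nu>I"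
    and ztE: "ztE = zE - inverse \<rho>E *\<^sub>R yE + inverse \<rho>E *\<^sub>R \<nu>E"
    using step[unfolded X W Xt X' W' flexqp_step.simps kkt_system_def] by blast
  have x': "x' = \<alpha> *\<^sub>R xt + (1 - \<alpha>) *\<^sub>R x"
    and s': "s' = pos_part (\<alpha> *\<^sub>R st + (1 - \<alpha>) *\<^sub>R s + inverse \<sigma>s *\<^sub>R ws)"
    and zI': "zI' = soft_threshold (\<mu>I / \<rho>I) (\<alpha> *\<^sub>R ztI + (1 - \<alpha>) *\<^sub>R zI + inverse \<rho>I *\<^sub>R yI)"
    and zE': "zE' = soft_threshold (\<mu>E / \<rho>E) (\<alpha> *\<^sub>R ztE + (1 - \<alpha>) *\<^sub>R zE + inverse \<rho>E *\<^sub>R yE)"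
    and ws': "ws' = ws + \<sigma>s *\<^sub>R (\<alpha> *\<^sub>R st + (1 - \<alpha>) *\<^sub>R s - s')"
    and yI': "yI' = yI + \<rho>I *\<^sub>R (\<alpha> *\<^sub>R ztI + (1 - \<alpha>) *\<^sub>R zI - zI')"
    and yE': "yE' = yE + \<rho>E *\<^sub>R (\<alpha> *\<^sub>R ztE + (1 - \<alpha>) *\<^sub>R zE - zE')"
    using step[unfolded X W Xt X' W' flexqp_step.simps] by blast+
  have "G *v xt = h - s + inverse \<sigma>s *\<^sub>R ws + zI - inverse \<rho>I *\<^sub>R yI + (inverse \<sigma>s + inverse \<rho>I) *\<^sub>R \<nu>I"
    using row2 by (simp only: diff_eq_eq)
  moreover have "A *v xt = b + zE - inverse \<rho>E *\<^sub>R yE + inverse \<rho>E *\<^sub>R \<nu>E"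
    using row3 by (simp only: diff_eq_eq)
  ultimately have dom: "(xt, st, ztI, ztE) \<in> split_f_dom G h A b"
    by (simp add: split_f_dom_def st ztI ztE scaleR_add_left)
  have "P *v xt + q + transpose G *v \<nu>I + transpose A *v \<nu>E = - (\<sigma>x *\<^sub>R (xt - x))"
  proof -
    have "(P + \<sigma>x *\<^sub>R mat 1) *v xt = P *v xt + \<sigma>x *\<^sub>R xt"
      by (simp add: matrix_vector_mult_add_rdistrib scaleR_matrix_vector_assoc[symmetric])
    then have "P *v xt + transpose G *v \<nu>I + transpose A *v \<nu>E = \<sigma>x *\<^sub>R x - q - \<sigma>x *\<^sub>R xt"
      using row1 by (simp add: algebra_simps)
    then show ?thesis by (simp add: algebra_simps)
  qed
  from split_f_subgradient[OF P dom this]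
  show ?F
    by (simp add: Xt X W split_scale_def st ztI ztE scaleR_diff_right scaleR_add_right pos[THEN less_imp_neq, symmetric])
  \<comment> \<open>The arguments of the projection and of the two soft thresholdings.\<close>
  define v1 where "v1 = \<alpha> *\<^sub>R st + (1 - \<alpha>) *\<^sub>R s + inverse \<sigma>s *\<^sub>R ws"
  define v2 where "v2 = \<alpha> *\<^sub>R ztI + (1 - \<alpha>) *\<^sub>R zI + inverse \<rho>I *\<^sub>R yI"
  define v3 where "v3 = \<alpha> *\<^sub>R ztE + (1 - \<alpha>) *\<^sub>R zE + inverse \<rho>E *\<^sub>R yE"
  have d: "ws' = \<sigma>s *\<^sub>R (v1 - pos_part v1)" "yI' = \<rho>I *\<^sub>R (v2 - soft_threshold (\<mu>I / \<rho>I) v2)"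
      "yE' = \<rho>E *\<^sub>R (v3 - soft_threshold (\<mu>E / \<rho>E) v3)"
    unfolding ws' yI' yE' s' zI' zE' v1_def[symmetric] v2_def[symmetric] v3_def[symmetric]
    using pos by (simp_all add: v1_def v2_def v3_def scaleR_diff_right scaleR_add_right)
  show ?G
    unfolding X' W'
  proof (rule split_g_subgradient)
    show "0 \<le> s'" unfolding s' by (rule pos_part_nonneg)
    show "ws' \<bullet> (s'' - s') \<le> 0" if "0 \<le> s''" for s''
      unfolding d s' v1_def[symmetric] by (rule pos_part_normal[OF pos(2) that])
    show "\<mu>I * norm1 zI' + yI' \<bullet> (z - zI') \<le> \<mu>I * norm1 z" for z
      unfolding d zI' v2_def[symmetric] by (rule soft_threshold_subgradient[OF pos(3) \<mu>(1)])
    show "\<mu>E * norm1 zE' + yE' \<bullet> (z - zE') \<le> \<mu>E * norm1 z" for z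
      unfolding d zE' v3_def[symmetric] by (rule soft_threshold_subgradient[OF pos(4) \<mu>(2)])
  qed
  show ?U
    by (simp add: X W Xt X' W' split_scale_def x' ws' yI' yE')
qed

section \<open>Convergence of the algorithm\<close>

theorem theorem3p2:
  fixes P :: "real^'n^'n" and q :: "real^'n"
    and G :: "real^'n^'m" and h :: "real^'m"
    and A :: "real^'n^'p" and b :: "real^'p"
    and \<mu>I \<mu>E \<sigma>x \<sigma>s \<rho>I \<rho>E \<alpha> :: real
    and Xt X :: "nat \<Rightarrow> ('n, 'm, 'p) split_vec"
    and W :: "nat \<Rightarrow> (real^'m) \<times> (real^'m) \<times> (real^'p)"
  assumes "pos_semidef P"
    and "\<mu>I > 0" and "\<mu>E > 0"
    and "bdd_below {relaxed_objective P q G h A b \<mu>I \<mu>E x s |x s. 0 \<le> s}"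
    and "\<sigma>x > 0" and "\<sigma>s > 0" and "\<rho>I > 0" and "\<rho>E > 0"
    and "0 < \<alpha>" and "\<alpha> < 2"
    and "\<And>k. flexqp_step P q G h A b \<mu>I \<mu>E \<sigma>x \<sigma>s \<rho>I \<rho>E \<alpha>
                (X k) (W k) (Xt (Suc k)) (X (Suc k)) (W (Suc k))"
  shows "\<exists>xt x y.
           saddle_point (lagrangian (split_f P q G h A b) (split_g \<mu>I \<mu>E)) xt x y \<and>
           (\<lambda>k. Xt (Suc k)) \<longlonglongrightarrow> xt \<and>
           X \<longlonglongrightarrow> x \<and>
           (\<lambda>k. (0, W k)) \<longlonglongrightarrow> y"
proof -
  let ?F = "subgradient_graph (split_f_dom G h A b) (split_f_val P q)"
  let ?G = "subgradient_graph (split_g_dom :: ('n, 'm, 'p) split_vec set) (split_g_val \<mu>I \<mu>E)"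
  let ?Q = "split_scale (sqrt \<sigma>x) (sqrt \<sigma>s) (sqrt \<rho>I) (sqrt \<rho>E) :: ('n, 'm, 'p) split_vec \<Rightarrow> _"
  let ?R = "split_scale (1 / sqrt \<sigma>x) (1 / sqrt \<sigma>s) (1 / sqrt \<rho>I) (1 / sqrt \<rho>E) :: ('n, 'm, 'p) split_vec \<Rightarrow> _"
  note pos = assms(5-8)
  note step = flexqp_step_admm[OF assms(1-3) pos assms(11)]
  have QQ: "?Q (?Q v) = split_scale \<sigma>x \<sigma>s \<rho>I \<rho>E v" for v
    using pos by (simp add: split_scale_split_scale)
  have RQ: "?R (?Q v) = v" "?Q (?R v) = v" for v
    using pos by (simp_all add: split_scale_split_scale split_scale_one)
  obtain xs ys where sol: "(xs, - ys) \<in> ?F" "(xs, ys) \<in> ?G"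
    using split_kkt_exists[OF assms(1-4)] by blast
  have "\<exists>xl yl. (xl, - yl) \<in> ?F \<and> (xl, yl) \<in> ?G \<and>
      (\<lambda>k. Xt (Suc k)) \<longlonglongrightarrow> xl \<and> X \<longlonglongrightarrow> xl \<and> (\<lambda>k. (0, W k)) \<longlonglongrightarrow> yl"
    by (rule relaxed_admm_converges[OF monotone_subgradient_graph monotone_subgradient_graph
          closed_split_f_subgradient closed_split_g_subgradient assms(9,10)
          linear_split_scale split_scale_self_adjoint linear_split_scale RQ _ _ _ sol])
       (unfold QQ, (rule step)+)
  then obtain xl yl where l: "(xl, - yl) \<in> ?F" "(xl, yl) \<in> ?G"
    "(\<lambda>k. Xt (Suc k)) \<longlonglongrightarrow> xl" "X \<longlonglongrightarrow> xl" "(\<lambda>k. (0, W k)) \<longlonglongrightarrow> yl"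
    by blast
  have "saddle_point (lagrangian (split_f P q G h A b) (split_g \<mu>I \<mu>E)) xl xl yl"
    by (rule saddle_point_of_subgradients[OF split_f_eq split_g_eq l(1,2)])
  with l(3-5) show ?thesis by blast
qed

end
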